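(* For every integer $n\ge 1$, \[ C(n) \ge \psi(n+1)-\log\!\bigl(1+\sqrt{3n+1}\bigr)+\frac12\log\!\left(\frac{3\pi}{2e}\right), \] where $\psi$ is the digamma function. In particular, for every $n\ge1$, \[ C(n) \ge \frac12\log\!\left(\frac{n\pi}{2e}\right) + r_{\rm LB}(n),\qquad r_{\rm LB}(n) := -\frac12\log\!\left(1+\frac{1}{3n}\right)+\log\!\left(1+\frac{1}{\sqrt{3n+1}}\right)+\frac{1}{n+1}. \]
   Context: All logarithms are natural. For an integer $n\ge1$, the binomial channel has input $X\in[0,1]$, output $Y\in\{0,\dots,n\}$ and transition law $P_{Y|X}(y|x)=\binom{n}{y}x^y(1-x)^{n-y}$. Its capacity is $C(n)=\max_{P_X} I(X;Y)$, the maximum taken over all probability distributions $P_X$ on $[0,1]$. *)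

theory Defs
  imports "HOL-Probability.Probability"
begin

definition binom_W :: "nat \<Rightarrow> real \<Rightarrow> nat \<Rightarrow> real" where
  "binom_W n x y = real (n choose y) * x ^ y * (1 - x) ^ (n - y)"

definition input_dist :: "real measure \<Rightarrow> bool" where
  "input_dist P \<longleftrightarrow> prob_space P \<and> sets P = sets borel \<and> measure P {0..1} = 1"

definition out_prob :: "nat \<Rightarrow> real measure \<Rightarrow> nat \<Rightarrow> real" where
  "out_prob n P y = (\<integral>x. binom_W n x y \<partial>P)"

definition mutual_info :: "nat \<Rightarrow> real measure \<Rightarrow> real" where
  "mutual_info n P =
     (\<integral>x. (\<Sum>y\<le>n. (if binom_W n x y = 0 then 0
                      else binom_W n x y * ln (binom_W n x y / out_prob n P y))) \<partial>P)"

definition capacity :: "nat \<Rightarrow> real" where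
  "capacity n = Sup (mutual_info n ` {P. input_dist P})"

end

theory Submission
  imports Defs
begin

text \<open>
  For weights \<open>k(u,y)\<close> with \<open>\<integral> k(u,y) du \<le> 1\<close>, playing the role of a reverse channel, Gibbs' inequality gives
  \<open>exp C(n) \<ge> \<integral> exp (\<Sum>y. W(y|x(u)) ln k(u,y)) du\<close>. The second bound of the theorem exceeds the arcsine-input
  bound by order \<open>1/\<surd>n\<close>, which is gained by giving the noiseless inputs \<open>0\<close> and \<open>1\<close> an atom each.
  For \<open>n \<ge> 10\<close> the input is these atoms together with a continuous part on \<open>[1/n, 1 - 1/n]\<close>, where \<open>k\<close> is the
  posterior \<open>(n+1) W(y|x)\<close> of the uniform prior, divided by \<open>4\<close> for \<open>y = 0\<close> and \<open>y = n\<close> to make room for the atoms;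
  then \<open>\<Sum>y. W ln W\<close> is bounded by the Gaussian estimate \<open>H(Bin(n,x)) \<le> 1/2 ln (2 \<pi> e (n x (1-x) + 1/12))\<close>.
  For \<open>n \<le> 9\<close> the inputs \<open>0, 1/2, 1\<close> suffice. The second bound implies the first because
  \<open>\<psi>(n+1) \<le> ln (n+1)\<close>.
\<close>

section \<open>The binomial channel: integrability and finiteness of the mutual information\<close>

lemma binom_W_eq_Bernstein: "binom_W n x y = Bernstein n y x"
  by (simp add: binom_W_def Bernstein_def)

lemma sum_binom_W: "(\<Sum>y\<le>n. binom_W n x y) = 1"
  by (simp add: binom_W_eq_Bernstein)

lemma binom_W_nonneg: "x \<in> {0..1} \<Longrightarrow> 0 \<le> binom_W n x y"
  by (simp add: binom_W_def)

lemma binom_W_le_1: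
  assumes "x \<in> {0..1}"
  shows "binom_W n x y \<le> 1"
proof (cases "y \<le> n")
  case True
  then have "binom_W n x y \<le> (\<Sum>y\<le>n. binom_W n x y)"
    using assms by (intro member_le_sum) (auto simp: binom_W_nonneg)
  then show ?thesis by (simp add: sum_binom_W)
qed (simp add: binom_W_def binomial_eq_0)

lemma borel_measurable_binom_W [measurable]: "(\<lambda>x. binom_W n x y) \<in> borel_measurable borel"
  unfolding binom_W_def by measurable

lemma input_dist_AE:
  assumes "input_dist P"
  shows "AE x in P. x \<in> {0..1}"
proof -
  interpret prob_space P using assms by (simp add: input_dist_def)
  show ?thesis
    using assms by (intro AE_prob_1) (simp add: input_dist_def)
qed

definition info_term :: "real \<Rightarrow> real \<Rightarrow> real" where
  "info_term q w = (if w = 0 then 0 else w * ln (w / q))"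

lemma borel_measurable_info_term [measurable]: "info_term q \<in> borel_measurable borel"
  unfolding info_term_def by measurable

lemma mutual_info_eq: "mutual_info n P = (\<integral>x. (\<Sum>y\<le>n. info_term (out_prob n P y) (binom_W n x y)) \<partial>P)"
  by (simp add: mutual_info_def info_term_def)

lemma abs_mult_ln_le_1:
  fixes w :: real
  assumes "0 \<le> w" "w \<le> 1"
  shows "\<bar>w * ln w\<bar> \<le> 1"
proof (cases "w = 0")
  case False
  with assms have w: "w > 0" by simp
  have "- ln w = ln (1 / w)" using w by (simp add: ln_div)
  also have "\<dots> \<le> 1 / w - 1" using w by (intro ln_le_minus_one) simp
  finally have "w * (- ln w) \<le> w * (1 / w - 1)" using w by (intro mult_left_mono) auto
  also have "\<dots> \<le> 1" using w by (simp add: algebra_simps)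
  finally have "- (w * ln w) \<le> 1" by simp
  moreover have "w * ln w \<le> 0" using w assms by (simp add: mult_nonneg_nonpos)
  ultimately show ?thesis by (simp add: abs_if)
qed simp

text \<open>The bound covers q = 0 as well: there \<open>w / q\<close> is 0 and
  \<open>ln 0 = 0\<close>, so the term vanishes.\<close>

lemma abs_info_term_le:
  assumes "0 \<le> w" "w \<le> 1" "0 \<le> q"
  shows "\<bar>info_term q w\<bar> \<le> 1 + \<bar>ln q\<bar>"
proof (cases "w = 0 \<or> q = 0")
  case False
  then have "info_term q w = w * ln w - w * ln q"
    using assms by (simp add: info_term_def ln_div right_diff_distrib)
  then have "\<bar>info_term q w\<bar> \<le> \<bar>w * ln w\<bar> + w * \<bar>ln q\<bar>"
    using assms by (simp add: abs_mult) (metis abs_triangle_ineq4 abs_mult abs_of_nonneg)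
  also have "\<dots> \<le> 1 + 1 * \<bar>ln q\<bar>"
    using assms by (intro add_mono mult_right_mono abs_mult_ln_le_1) auto
  finally show ?thesis by simp
qed (auto simp: info_term_def)

lemma out_prob_nonneg:
  assumes "input_dist P"
  shows "0 \<le> out_prob n P y"
  unfolding out_prob_def
  by (intro integral_nonneg_AE eventually_mono[OF input_dist_AE[OF assms]] binom_W_nonneg)

lemma integrable_binom_W:
  assumes "input_dist P"
  shows "integrable P (\<lambda>x. binom_W n x y)"
proof -
  interpret prob_space P using assms by (simp add: input_dist_def)
  have [measurable_cong]: "sets P = sets borel" using assms by (simp add: input_dist_def)
  show ?thesis
    by (intro integrable_const_bound[where B=1] eventually_mono[OF input_dist_AE[OF assms]])
       (simp_all add: binom_W_nonneg binom_W_le_1)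
qed

lemma integrable_info_term:
  assumes "input_dist P" "0 \<le> q"
  shows "integrable P (\<lambda>x. info_term q (binom_W n x y))"
proof -
  interpret prob_space P using assms by (simp add: input_dist_def)
  have [measurable_cong]: "sets P = sets borel" using assms by (simp add: input_dist_def)
  show ?thesis
    by (intro integrable_const_bound[where B="1 + \<bar>ln q\<bar>"] eventually_mono[OF input_dist_AE[OF assms(1)]])
       (simp_all add: binom_W_nonneg binom_W_le_1 assms abs_info_term_le)
qed

text \<open>\<open>capacity\<close> is a real supremum, so a mutual information lies below it only
  once boundedness is known; a crude bound is enough for that. Dropping w ln w <= 0 leaves - q ln q
  <= 1 for each of the n + 1 outputs.\<close>

lemma mutual_info_le:
  assumes "input_dist P"
  shows "mutual_info n P \<le> real (Suc n)"
proof -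
  interpret prob_space P using assms by (simp add: input_dist_def)
  let ?q = "out_prob n P"
  have le_1: "(\<integral>x. info_term (?q y) (binom_W n x y) \<partial>P) \<le> 1" for y
  proof -
    have q0: "0 \<le> ?q y" using assms by (rule out_prob_nonneg)
    have q1: "?q y \<le> 1"
      unfolding out_prob_def
      by (intro integral_le_const integrable_binom_W assms eventually_mono[OF input_dist_AE[OF assms]] binom_W_le_1)
    have "info_term (?q y) w \<le> w * (- ln (?q y))" if "0 \<le> w" "w \<le> 1" for w
      using that q0 mult_nonneg_nonpos[of w "ln w"]
      by (cases "?q y = 0") (auto simp: info_term_def ln_div right_diff_distrib)
    then have "(\<integral>x. info_term (?q y) (binom_W n x y) \<partial>P) \<le> (\<integral>x. binom_W n x y * (- ln (?q y)) \<partial>P)"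
      using assms q0
      by (intro integral_mono_AE integrable_info_term integrable_mult_left integrable_binom_W
            eventually_mono[OF input_dist_AE[OF assms]])
         (simp_all add: binom_W_nonneg binom_W_le_1)
    also have "\<dots> = - (?q y * ln (?q y))"
      by (simp add: out_prob_def)
    also have "\<dots> \<le> 1" using abs_mult_ln_le_1[OF q0 q1] by linarith
    finally show ?thesis .
  qed
  have "mutual_info n P = (\<Sum>y\<le>n. (\<integral>x. info_term (?q y) (binom_W n x y) \<partial>P))"
    unfolding mutual_info_eq using assms
    by (intro Bochner_Integration.integral_sum integrable_info_term out_prob_nonneg)
  also have "\<dots> \<le> (\<Sum>y\<le>n. 1)" by (intro sum_mono le_1)
  finally show ?thesis by simp
qed

lemma mutual_info_le_capacity:
  assumes "input_dist P"
  shows "mutual_info n P \<le> capacity n"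
  unfolding capacity_def
proof (rule cSup_upper)
  show "bdd_above (mutual_info n ` {P. input_dist P})"
    by (rule bdd_aboveI2[where M="real (Suc n)"]) (use mutual_info_le in auto)
qed (use assms in auto)

section \<open>The variational lower bound on the capacity\<close>

text \<open>The input law has density p = h / Z with respect to M, where Z is the integral of h, and
  is pushed to [0, 1] by \<phi>. Replacing the true posterior by k(u, y) can only lower the mutual
  information, and the lowered value is the mean under p of the sum of W ln (k / p), which is at
  least the mean of ln (h / p) = ln Z. Labels in an arbitrary measure space M treat finite inputs,
  atoms and densities alike.\<close>

lemma capacity_ge_ln_integral:
  fixes M :: "'a measure" and \<phi> h :: "'a \<Rightarrow> real" and k :: "'a \<Rightarrow> nat \<Rightarrow> real"
  assumes [measurable]: "\<phi> \<in> borel_measurable M"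
    and range: "\<And>u. u \<in> space M \<Longrightarrow> \<phi> u \<in> {0..1}"
    and h: "integrable M h" "\<And>u. u \<in> space M \<Longrightarrow> 0 \<le> h u" "0 < integral\<^sup>L M h"
    and k: "\<And>y. y \<le> n \<Longrightarrow> integrable M (\<lambda>u. k u y)" "\<And>u y. u \<in> space M \<Longrightarrow> 0 \<le> k u y"
      "\<And>y. y \<le> n \<Longrightarrow> (\<integral>u. k u y \<partial>M) \<le> 1"
    and pos: "\<And>u y. u \<in> space M \<Longrightarrow> 0 < h u \<Longrightarrow> y \<le> n \<Longrightarrow> 0 < binom_W n (\<phi> u) y \<Longrightarrow> 0 < k u y"
    and le: "\<And>u. u \<in> space M \<Longrightarrow> 0 < h u \<Longrightarrow> ln (h u) \<le> (\<Sum>y\<le>n. binom_W n (\<phi> u) y * ln (k u y))"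
  shows "ln (integral\<^sup>L M h) \<le> capacity n"
proof -
  define Z where "Z = integral\<^sup>L M h"
  have Z: "Z > 0" using h by (simp add: Z_def)
  define p where "p u = h u / Z" for u
  have p: "integrable M p" "\<And>u. u \<in> space M \<Longrightarrow> 0 \<le> p u" "integral\<^sup>L M p = 1"
    using h Z by (auto simp: p_def[abs_def] Z_def)
  have [measurable]: "p \<in> borel_measurable M" using p by auto
  define P where "P = distr (density M (\<lambda>u. ennreal (p u))) borel \<phi>"
  have emeasure_p: "emeasure (density M (\<lambda>u. ennreal (p u))) (space M) = 1"
    using p nn_integral_eq_integral[OF p(1)] by (simp add: emeasure_density AE_I2 cong: nn_integral_cong)
  interpret D: prob_space "density M (\<lambda>u. ennreal (p u))"
    by (rule prob_spaceI) (simp add: emeasure_p)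
  interpret P: prob_space P
    unfolding P_def by (rule D.prob_space_distr) simp
  have P_int: "integral\<^sup>L P f = (\<integral>u. p u * f (\<phi> u) \<partial>M)" if [measurable]: "f \<in> borel_measurable borel" for f :: "real \<Rightarrow> real"
    unfolding P_def using p(2)
    by (subst integral_distr) (auto simp: integral_density)
  have P_integrable: "integrable P f \<longleftrightarrow> integrable M (\<lambda>u. p u * f (\<phi> u))" if [measurable]: "f \<in> borel_measurable borel" for f :: "real \<Rightarrow> real"
    unfolding P_def using p(2)
    by (subst integrable_distr_eq) (auto simp: integrable_density)
  have "AE x in P. x \<in> {0..1}"
    unfolding P_def using range by (subst AE_distr_iff) (auto simp: AE_density)
  then have "measure P {0..1} = 1"
    by (subst P.prob_eq_1) (auto simp: P_def)
  then have in_P: "input_dist P"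
    by (simp add: input_dist_def P.prob_space_axioms) (simp add: P_def)
  let ?q = "out_prob n P"
  have q: "?q y = (\<integral>u. p u * binom_W n (\<phi> u) y \<partial>M)" for y
    unfolding out_prob_def by (rule P_int) simp
  have q0: "0 \<le> ?q y" for y using in_P by (rule out_prob_nonneg)
  have int_pW: "integrable M (\<lambda>u. p u * binom_W n (\<phi> u) y)" for y
    using integrable_binom_W[OF in_P] by (subst (asm) P_integrable) auto
  \<comment> \<open>Where the output probability q is 0 the value \<open>ln 0 = 0\<close> would
    spoil the termwise inequality. But q is the integral of the nonnegative p W, so p W vanishes
    almost everywhere there.\<close>
  have AE_q: "AE u in M. \<forall>y\<le>n. ?q y = 0 \<longrightarrow> p u * binom_W n (\<phi> u) y = 0"
  proof -
    have "AE u in M. ?q y = 0 \<longrightarrow> p u * binom_W n (\<phi> u) y = 0" for y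
    proof (cases "?q y = 0")
      case True
      moreover have "AE u in M. 0 \<le> p u * binom_W n (\<phi> u) y"
        using p(2) range by (auto intro!: AE_I2 simp: binom_W_nonneg)
      ultimately have "AE u in M. p u * binom_W n (\<phi> u) y = 0"
        using int_pW[of y] by (simp add: q integral_nonneg_eq_0_iff_AE)
      then show ?thesis by simp
    qed simp
    then show ?thesis by (simp add: AE_all_countable)
  qed
  let ?F = "\<lambda>x. \<Sum>y\<le>n. info_term (?q y) (binom_W n x y)"
  \<comment> \<open>The left side is linear in p and k, hence integrable by hypothesis; no
    integrability of ln k or ln p is ever needed. On integration the extra 1 is cancelled by the sum
    of q k, whose integral is at most 1.\<close>
  have key: "p u * (ln Z + 1) - (\<Sum>y\<le>n. ?q y * k u y) \<le> p u * ?F (\<phi> u)"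
    if u: "u \<in> space M" and qz: "\<forall>y\<le>n. ?q y = 0 \<longrightarrow> p u * binom_W n (\<phi> u) y = 0" for u
  proof (cases "p u = 0")
    case True
    then show ?thesis using k(2)[OF u] q0 by (simp add: sum_nonneg)
  next
    case False
    then have pu: "0 < p u" using p(2)[OF u] by simp
    then have hu: "0 < h u" using Z by (simp add: p_def zero_less_divide_iff)
    let ?w = "\<lambda>y. binom_W n (\<phi> u) y"
    have w0: "0 \<le> ?w y" for y using range[OF u] by (rule binom_W_nonneg)
    have "?w y * (ln (k u y) - ln (p u) + 1) - ?q y * k u y / p u \<le> info_term (?q y) (?w y)" if "y \<le> n" for y
    proof (cases "?w y = 0")
      case True
      then show ?thesis using k(2)[OF u] q0 pu by (simp add: info_term_def)
    next
      case False
      then have wy: "0 < ?w y" using w0[of y] by simp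
      then have ky: "0 < k u y" using pos[OF u hu that] by simp
      have qy: "0 < ?q y" using qz that wy pu q0[of y] by (cases "?q y = 0") auto
      \<comment> \<open>The ratio of q(y) k(u, y) to the joint density p(u) W(y|u); the inequality
        ln t <= t - 1 at this t is Gibbs' inequality before integration.\<close>
      define t where "t = ?q y * k u y / (?w y * p u)"
      have t: "0 < t" using wy ky qy pu by (simp add: t_def)
      have "ln t \<le> t - 1" using t by (rule ln_le_minus_one)
      also have "ln t = ln (?q y) + ln (k u y) - ln (?w y) - ln (p u)"
        using wy ky qy pu by (simp add: t_def ln_div ln_mult)
      finally have "?w y * (ln (k u y) - ln (p u) + 1 - t) \<le> ?w y * (ln (?w y) - ln (?q y))"
        using wy by (intro mult_left_mono) auto
      moreover have "?w y * t = ?q y * k u y / p u" using wy by (simp add: t_def)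
      ultimately show ?thesis using wy qy by (simp add: info_term_def ln_div algebra_simps)
    qed
    then have "(\<Sum>y\<le>n. ?w y * (ln (k u y) - ln (p u) + 1) - ?q y * k u y / p u) \<le> ?F (\<phi> u)"
      by (intro sum_mono) simp
    also have "(\<Sum>y\<le>n. ?w y * (ln (k u y) - ln (p u) + 1) - ?q y * k u y / p u)
        = (\<Sum>y\<le>n. ?w y * ln (k u y)) + (\<Sum>y\<le>n. ?w y) * (1 - ln (p u)) - (\<Sum>y\<le>n. ?q y * k u y) / p u"
      by (simp add: sum_subtractf sum.distrib sum_distrib_left sum_divide_distrib algebra_simps)
    finally have "ln (h u) + 1 - ln (p u) - (\<Sum>y\<le>n. ?q y * k u y) / p u \<le> ?F (\<phi> u)"
      using le[OF u hu] by (simp add: sum_binom_W)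
    moreover have "ln (h u) - ln (p u) = ln Z" using hu Z by (simp add: p_def ln_div)
    ultimately have "p u * (ln Z + 1 - (\<Sum>y\<le>n. ?q y * k u y) / p u) \<le> p u * ?F (\<phi> u)"
      using pu by (intro mult_left_mono) auto
    then show ?thesis using pu by (simp add: right_diff_distrib)
  qed
  have int_F: "integrable M (\<lambda>u. p u * ?F (\<phi> u))"
    using in_P q0 by (subst P_integrable[symmetric]) (auto intro!: integrable_info_term)
  have "(\<Sum>y\<le>n. ?q y * (\<integral>u. k u y \<partial>M)) \<le> (\<Sum>y\<le>n. ?q y * 1)"
    using q0 k(3) by (intro sum_mono mult_left_mono) auto
  also have "\<dots> = (\<integral>x. (\<Sum>y\<le>n. binom_W n x y) \<partial>P)"
    unfolding out_prob_def using in_P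
    by (subst Bochner_Integration.integral_sum) (auto intro!: integrable_binom_W)
  also have "\<dots> = 1" by (simp add: sum_binom_W P.prob_space)
  finally have "ln Z \<le> (ln Z + 1) - (\<Sum>y\<le>n. ?q y * (\<integral>u. k u y \<partial>M))" by simp
  also have "\<dots> = (\<integral>u. p u * (ln Z + 1) - (\<Sum>y\<le>n. ?q y * k u y) \<partial>M)"
    using p k(1) by (subst Bochner_Integration.integral_diff)
      (auto intro!: Bochner_Integration.integrable_sum simp: Bochner_Integration.integral_sum)
  also have "\<dots> \<le> (\<integral>u. p u * ?F (\<phi> u) \<partial>M)"
  proof (rule integral_mono_AE)
    show "integrable M (\<lambda>u. p u * (ln Z + 1) - (\<Sum>y\<le>n. ?q y * k u y))"
      using p k(1) by (auto intro!: Bochner_Integration.integrable_sum Bochner_Integration.integrable_diff)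
    show "AE u in M. p u * (ln Z + 1) - (\<Sum>y\<le>n. ?q y * k u y) \<le> p u * ?F (\<phi> u)"
      using AE_q AE_space by eventually_elim (rule key)
  qed (rule int_F)
  also have "\<dots> = mutual_info n P"
    unfolding mutual_info_eq by (rule P_int[symmetric]) simp
  also have "\<dots> \<le> capacity n" using in_P by (rule mutual_info_le_capacity)
  finally show ?thesis by (simp add: Z_def)
qed

section \<open>The Gaussian bound on the binomial entropy\<close>

lemma binom_W_variance:
  "(\<Sum>y\<le>n. binom_W n x y * (real y - real n * x)\<^sup>2) = real n * x * (1 - x)"
proof -
  have "(\<Sum>y\<le>n. binom_W n x y * (real y - real n * x)\<^sup>2)
      = (\<Sum>y\<le>n. real y * (real y - 1) * Bernstein n y x + (1 - 2 * real n * x) * (real y * Bernstein n y x)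
           + (real n * x)\<^sup>2 * Bernstein n y x)"
    by (intro sum.cong) (simp_all add: binom_W_eq_Bernstein power2_eq_square algebra_simps)
  also have "\<dots> = real n * (real n - 1) * x\<^sup>2 + (1 - 2 * real n * x) * (real n * x) + (real n * x)\<^sup>2 * 1"
    by (simp add: sum.distrib flip: sum_distrib_left)
  also have "\<dots> = real n * x * (1 - x)"
    by (simp add: power2_eq_square algebra_simps)
  finally show ?thesis .
qed

text \<open>Jensen's inequality on a unit cell, which costs the variance $1/12$ of the uniform law.\<close>

lemma normal_density_cell:
  fixes c m \<sigma> :: real
  assumes \<sigma>: "0 < \<sigma>"
  shows "1 / sqrt (2 * pi * \<sigma>\<^sup>2) * exp (- (((c - m)\<^sup>2 + 1/12) / (2 * \<sigma>\<^sup>2)))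
          \<le> integral {c - 1/2..c + 1/2} (normal_density m \<sigma>)"
proof -
  define b where "b = ((c - m)\<^sup>2 + 1/12) / (2 * \<sigma>\<^sup>2)"
  define K where "K = 1 / sqrt (2 * pi * \<sigma>\<^sup>2)"
  \<comment> \<open>The normal density is K exp (- b) times the exponential of b - (t - m)^2 / (2
    \<sigma>^2); g replaces that exponential by its tangent at 0. Since (t - m)^2 has mean (c - m)^2
    + 1/12 over the cell, this b makes the linear correction integrate to 0. G is an antiderivative
    of g.\<close>
  define g where "g t = K * exp (- b) * (1 + b - (t - m)\<^sup>2 / (2 * \<sigma>\<^sup>2))" for t
  define G where "G t = K * exp (- b) * ((1 + b) * t - (t - m) ^ 3 / (6 * \<sigma>\<^sup>2))" for t
  have "(G has_vector_derivative g t) (at t within S)" for t S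
    unfolding G_def g_def using \<sigma>
    by (auto intro!: derivative_eq_intros simp: has_real_derivative_iff_has_vector_derivative[symmetric] field_simps)
  then have "(g has_integral (G (c + 1/2) - G (c - 1/2))) {c - 1/2..c + 1/2}"
    by (intro fundamental_theorem_of_calculus) auto
  moreover have "G (c + 1/2) - G (c - 1/2) = K * exp (- b)"
  proof -
    have "(c + 1/2 - m) ^ 3 - (c - 1/2 - m) ^ 3 = 3 * ((c - m)\<^sup>2 + 1/12)"
      by (simp add: power3_eq_cube power2_eq_square algebra_simps)
    then have "((c + 1/2 - m) ^ 3 - (c - 1/2 - m) ^ 3) / (6 * \<sigma>\<^sup>2) = 3 * ((c - m)\<^sup>2 + 1/12) / (6 * \<sigma>\<^sup>2)"
      by simp
    also have "\<dots> = b" using \<sigma> by (simp add: b_def divide_simps)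
    finally have "((c + 1/2 - m) ^ 3 - (c - 1/2 - m) ^ 3) / (6 * \<sigma>\<^sup>2) = b" .
    then show ?thesis
      by (simp add: G_def diff_divide_distrib right_diff_distrib[symmetric] algebra_simps)
  qed
  ultimately have g: "(g has_integral K * exp (- b)) {c - 1/2..c + 1/2}" by simp
  have "g t \<le> normal_density m \<sigma> t" for t
  proof -
    have "1 + (b - (t - m)\<^sup>2 / (2 * \<sigma>\<^sup>2)) \<le> exp (b - (t - m)\<^sup>2 / (2 * \<sigma>\<^sup>2))"
      by (rule exp_ge_add_one_self)
    then have "K * exp (- b) * (1 + (b - (t - m)\<^sup>2 / (2 * \<sigma>\<^sup>2)))
        \<le> K * exp (- b) * exp (b - (t - m)\<^sup>2 / (2 * \<sigma>\<^sup>2))"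
      by (intro mult_left_mono) (auto simp: K_def)
    also have "\<dots> = normal_density m \<sigma> t"
      by (simp add: normal_density_def K_def mult.assoc exp_add[symmetric])
    finally show ?thesis by (simp add: g_def add.assoc[symmetric] add_diff_eq)
  qed
  moreover have "normal_density m \<sigma> integrable_on {c - 1/2..c + 1/2}"
    by (intro integrable_continuous_real continuous_intros)
       (use \<sigma> in \<open>auto simp: normal_density_def[abs_def] intro!: continuous_intros\<close>)
  ultimately have "K * exp (- b) \<le> integral {c - 1/2..c + 1/2} (normal_density m \<sigma>)"
    using integral_le[of g] g by (metis has_integral_integrable integral_unique)
  then show ?thesis by (simp add: K_def b_def)
qed

lemma sum_normal_density_cells_le_1:
  assumes \<sigma>: "0 < \<sigma>"
  shows "(\<Sum>y\<le>n. integral {real y - 1/2..real y + 1/2} (normal_density m \<sigma>)) \<le> 1"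
proof -
  have int: "normal_density m \<sigma> integrable_on {a..b}" for a b
    by (intro integrable_continuous_real)
       (use \<sigma> in \<open>auto simp: normal_density_def[abs_def] intro!: continuous_intros\<close>)
  have "(\<Sum>y\<le>n. integral {real y - 1/2..real y + 1/2} (normal_density m \<sigma>))
      = integral {- 1/2..real n + 1/2} (normal_density m \<sigma>)"
  proof (induction n)
    case (Suc n)
    have "integral {- 1/2..real n + 1/2} (normal_density m \<sigma>) + integral {real n + 1/2..real n + 3/2} (normal_density m \<sigma>)
        = integral {- 1/2..real n + 3/2} (normal_density m \<sigma>)"
      by (rule Henstock_Kurzweil_Integration.integral_combine) (auto intro: int)
    with Suc show ?case by (simp add: add.commute)
  qed simp
  also have "\<dots> = (LINT t:{- 1/2..real n + 1/2}|lborel. normal_density m \<sigma> t)"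
    using \<sigma> by (intro set_borel_integral_eq_integral(2)[symmetric])
      (unfold set_integrable_def, intro integrable_mult_indicator integrable_normal_density, auto)
  also have "\<dots> \<le> (\<integral>t. normal_density m \<sigma> t \<partial>lborel)"
    unfolding set_lebesgue_integral_def using \<sigma>
    by (intro integral_mono integrable_mult_indicator integrable_normal_density)
       (auto simp: indicator_def normal_density_nonneg)
  also have "\<dots> = 1" using \<sigma> by simp
  finally show ?thesis .
qed

text \<open>Gibbs' inequality against Q, a lower bound for the masses that a Gaussian with mean n x
  gives to the unit cells around 0, ..., n; hence Q has total at most 1. Its variance V is that of
  the binomial law plus 1/12, so (y - m)^2 + 1/12 has mean exactly V and contributes 1/2. The 1/12
  also keeps V positive at x = 0 and x = 1.\<close>

lemma binomial_entropy_le: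
  assumes x: "x \<in> {0..1}"
  shows "- (\<Sum>y\<le>n. binom_W n x y * ln (binom_W n x y))
          \<le> ln (2 * pi * exp 1 * (real n * x * (1 - x) + 1/12)) / 2"
proof -
  define V where "V = real n * x * (1 - x) + 1/12"
  define \<sigma> where "\<sigma> = sqrt V"
  define m where "m = real n * x"
  have "0 \<le> real n * x * (1 - x)" using x by simp
  then have V: "V > 0" by (simp add: V_def)
  then have \<sigma>: "\<sigma> > 0" "\<sigma>\<^sup>2 = V" by (auto simp: \<sigma>_def)
  define Q where "Q y = 1 / sqrt (2 * pi * V) * exp (- (((real y - m)\<^sup>2 + 1/12) / (2 * V)))" for y :: nat
  have Q: "Q y > 0" for y using V by (simp add: Q_def)
  have "(\<Sum>y\<le>n. Q y) \<le> (\<Sum>y\<le>n. integral {real y - 1/2..real y + 1/2} (normal_density m \<sigma>))"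
    using normal_density_cell[OF \<sigma>(1)] \<sigma>(2) by (intro sum_mono) (simp add: Q_def)
  also have "\<dots> \<le> 1" by (rule sum_normal_density_cells_le_1[OF \<sigma>(1)])
  finally have sumQ: "(\<Sum>y\<le>n. Q y) \<le> 1" .
  have ln_Q: "ln (Q y) = - ln (2 * pi * V) / 2 - ((real y - m)\<^sup>2 + 1/12) / (2 * V)" for y
    using V by (simp add: Q_def ln_mult ln_div ln_sqrt field_simps)
  let ?w = "binom_W n x"
  have w0: "0 \<le> ?w y" for y using x by (rule binom_W_nonneg)
  have gibbs: "?w y * ln (Q y) - ?w y * ln (?w y) \<le> Q y - ?w y" for y
  proof (cases "?w y = 0")
    case False
    then have w: "?w y > 0" using w0[of y] by simp
    have "ln (Q y / ?w y) \<le> Q y / ?w y - 1" using Q w by (intro ln_le_minus_one) simp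
    then have "?w y * ln (Q y / ?w y) \<le> ?w y * (Q y / ?w y - 1)" using w by (intro mult_left_mono) auto
    then show ?thesis using w Q[of y] by (simp add: ln_div right_diff_distrib)
  qed (use Q[of y] in simp)
  have "(\<Sum>y\<le>n. ?w y * ln (Q y)) - (\<Sum>y\<le>n. ?w y * ln (?w y)) \<le> (\<Sum>y\<le>n. Q y) - (\<Sum>y\<le>n. ?w y)"
    unfolding sum_subtractf[symmetric] by (intro sum_mono gibbs)
  also have "\<dots> \<le> 0" using sumQ by (simp add: sum_binom_W)
  finally have "- (\<Sum>y\<le>n. ?w y * ln (?w y)) \<le> - (\<Sum>y\<le>n. ?w y * ln (Q y))" by simp
  also have "(\<Sum>y\<le>n. ?w y * ln (Q y)) = (\<Sum>y\<le>n. ?w y * (- ln (2 * pi * V) / 2 - 1 / (24 * V)) - ?w y * (real y - m)\<^sup>2 / (2 * V))"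
    by (intro sum.cong) (simp_all add: ln_Q algebra_simps add_divide_distrib)
  also have "\<dots> = (- ln (2 * pi * V) / 2 - 1 / (24 * V)) - (V - 1/12) / (2 * V)"
    using binom_W_variance[of n x]
    by (simp add: sum_subtractf sum_binom_W V_def m_def flip: sum_distrib_right sum_divide_distrib)
  also have "- \<dots> = (ln (2 * pi * V) + 1) / 2"
    using V by (simp add: field_simps)
  also have "\<dots> = ln (2 * pi * exp 1 * V) / 2"
    using V by (simp add: ln_mult)
  finally show ?thesis by (simp add: V_def)
qed

section \<open>The three-point input\<close>

text \<open>Label u stands for the input u / 2. Outputs 0 and n are attributed to the matching
  endpoint with weight \<theta> and to 1/2 with weight 1 - \<theta>, all other outputs to 1/2 alone.
  Input 1/2 hits {0, n} with probability 2 / 2^n, which gives the exponent; n >= 1 makes these two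
  outputs distinct.\<close>

lemma capacity_ge_three_point:
  assumes n: "n \<ge> 1" and \<theta>: "0 < \<theta>" "\<theta> < 1"
  shows "ln (2 * \<theta> + (1 - \<theta>) powr (2 / 2 ^ n)) \<le> capacity n"
proof -
  define M where "M = count_space {0, 1, 2 :: nat}"
  define \<phi> :: "nat \<Rightarrow> real" where "\<phi> u = real u / 2" for u
  define h where "h u = (if u = 1 then (1 - \<theta>) powr (2 / 2 ^ n) else \<theta>)" for u :: nat
  define k where "k u y = (if u = 1 then (if y = 0 \<or> y = n then 1 - \<theta> else 1)
      else if (u = 0 \<and> y = 0) \<or> (u = 2 \<and> y = n) then \<theta> else 0)" for u y :: nat
  have sp: "space M = {0, 1, 2}" by (simp add: M_def)
  have Mint: "integral\<^sup>L M f = f 0 + f 1 + f 2" for f :: "nat \<Rightarrow> real"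
    by (simp add: M_def lebesgue_integral_count_space_finite)
  have Mintegrable: "integrable M f" for f :: "nat \<Rightarrow> real"
    unfolding M_def by (rule integrable_count_space) simp
  have W0: "binom_W n 0 y = (if y = 0 then 1 else 0)" for y
    by (simp add: binom_W_def power_0_left)
  have W1: "binom_W n 1 y = (if y = n then 1 else 0)" if "y \<le> n" for y
    using that by (auto simp: binom_W_def power_0_left)
  have "(\<Sum>y\<le>n. binom_W n (1/2) y * ln (k 1 y)) = (\<Sum>y\<in>{0, n}. binom_W n (1/2) y * ln (k 1 y))"
    by (rule sum.mono_neutral_right) (auto simp: k_def)
  also have "\<dots> = 2 / 2 ^ n * ln (1 - \<theta>)"
    using n by (simp add: k_def binom_W_def power_one_over field_simps)
  finally have mid: "(\<Sum>y\<le>n. binom_W n (1/2) y * ln (k 1 y)) = 2 / 2 ^ n * ln (1 - \<theta>)" .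
  have "ln (integral\<^sup>L M h) \<le> capacity n"
  proof (rule capacity_ge_ln_integral[where \<phi> = \<phi> and k = k])
    show "\<phi> \<in> borel_measurable M" by (simp add: M_def)
    show "\<phi> u \<in> {0..1}" if "u \<in> space M" for u using that by (auto simp: sp \<phi>_def)
    show "0 \<le> h u" for u using \<theta> by (simp add: h_def)
    show "0 < integral\<^sup>L M h" using \<theta> by (simp add: Mint h_def add_pos_pos)
    show "0 \<le> k u y" for u y using \<theta> by (simp add: k_def)
    show "(\<integral>u. k u y \<partial>M) \<le> 1" for y using n \<theta> by (auto simp: Mint k_def)
    show "0 < k u y" if "u \<in> space M" "y \<le> n" "0 < binom_W n (\<phi> u) y" for u y
      using that \<theta> by (auto simp: sp k_def \<phi>_def W0 W1 split: if_splits)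
    show "ln (h u) \<le> (\<Sum>y\<le>n. binom_W n (\<phi> u) y * ln (k u y))" if "u \<in> space M" for u
    proof -
      have "(\<Sum>y\<le>n. binom_W n 0 y * ln (k 0 y)) = (\<Sum>y\<le>n. if y = 0 then ln \<theta> else 0)"
        by (intro sum.cong) (auto simp: W0 k_def)
      moreover have "(\<Sum>y\<le>n. binom_W n 1 y * ln (k 2 y)) = (\<Sum>y\<le>n. if y = n then ln \<theta> else 0)"
        by (intro sum.cong) (auto simp: W1 k_def)
      ultimately show ?thesis
        using that mid \<theta> by (auto simp: sp \<phi>_def h_def ln_powr)
    qed
  qed (simp_all add: Mintegrable)
  also have "integral\<^sup>L M h = 2 * \<theta> + (1 - \<theta>) powr (2 / 2 ^ n)"
    by (simp add: Mint h_def)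
  finally show ?thesis .
qed

section \<open>Two atoms together with a continuous part\<close>

text \<open>A Beta integral. It does not depend on y: a uniform input makes all n + 1 outputs
  equally likely, so that (n + 1) W is the posterior density.\<close>

lemma has_integral_binom_W:
  assumes "y \<le> n"
  shows "((\<lambda>x. binom_W n x y) has_integral 1 / (real n + 1)) {0..1}"
proof -
  have "((\<lambda>t. t powr (real (Suc y) - 1) * (1 - t) powr (real (Suc (n - y)) - 1))
      has_integral Beta (real (Suc y)) (real (Suc (n - y)))) {0<..<1}"
    using has_integral_Beta_real[of "real (Suc y)" "real (Suc (n - y))"] by (simp add: has_integral_Icc_iff_Ioo)
  also have "?this \<longleftrightarrow> ((\<lambda>t. t ^ y * (1 - t) ^ (n - y)) has_integral Beta (real (Suc y)) (real (Suc (n - y)))) {0<..<1}"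
    by (intro has_integral_cong) (simp add: powr_realpow)
  also have "Beta (real (Suc y)) (real (Suc (n - y))) = fact y * fact (n - y) / fact (Suc n)"
  proof -
    have "real (Suc y) + real (Suc (n - y)) = 1 + real (Suc n)" using assms by simp
    then show ?thesis
      unfolding Beta_def using Gamma_fact[of y, where 'a=real] Gamma_fact[of "n - y", where 'a=real]
        Gamma_fact[of "Suc n", where 'a=real] by (simp add: add.commute)
  qed
  finally have "((\<lambda>t. real (n choose y) * (t ^ y * (1 - t) ^ (n - y))) has_integral
      real (n choose y) * (fact y * fact (n - y) / fact (Suc n))) {0..1}"
    unfolding has_integral_Icc_iff_Ioo by (rule has_integral_mult_right)
  moreover have "real (n choose y) * (fact y * fact (n - y) / fact (Suc n)) = 1 / (real n + 1)"
    using assms by (simp add: binomial_fact)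
  ultimately show ?thesis by (simp add: binom_W_def mult.assoc)
qed

text \<open>Completing the square gives n x (1 - x) + 1/12 = (n / 4) (b^2 - (2 x - 1)^2) with b^2 =
  1 + 1 / (3 n), so arcsin ((2 x - 1) / b) / sqrt n is an antiderivative. As b > 1, it stays
  differentiable on all of [0, 1].\<close>

lemma has_integral_inverse_sqrt_quadratic:
  assumes n: "n \<ge> 1" and \<delta>: "0 \<le> \<delta>" "\<delta> \<le> 1/2"
  shows "((\<lambda>x. 1 / sqrt (real n * x * (1 - x) + 1/12)) has_integral
           2 * arcsin ((1 - 2 * \<delta>) / sqrt (1 + 1 / (3 * real n))) / sqrt (real n)) {\<delta>..1 - \<delta>}"
proof -
  define b where "b = sqrt (1 + 1 / (3 * real n))"
  have b: "b > 1" "b\<^sup>2 = 1 + 1 / (3 * real n)" using n by (auto simp: b_def)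
  define F where "F x = arcsin ((2 * x - 1) / b) / sqrt (real n)" for x
  have "(F has_real_derivative 1 / sqrt (real n * x * (1 - x) + 1/12)) (at x within {\<delta>..1 - \<delta>})"
    if x: "x \<in> {\<delta>..1 - \<delta>}" for x
  proof -
    have x01: "0 \<le> x" "x \<le> 1" using x \<delta> by auto
    have lt: "- 1 < (2 * x - 1) / b" "(2 * x - 1) / b < 1"
      using b x01 by (auto simp: divide_simps)
    define V where "V = real n * x * (1 - x) + 1/12"
    have "1 - ((2 * x - 1) / b)\<^sup>2 = (b\<^sup>2 - (2 * x - 1)\<^sup>2) / b\<^sup>2"
      using b(1) unfolding power_divide by (simp add: diff_divide_distrib[of "b\<^sup>2"])
    also have "b\<^sup>2 - (2 * x - 1)\<^sup>2 = 4 / real n * V"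
      unfolding b(2) V_def using n by (simp add: field_simps power2_eq_square)
    finally have "sqrt (1 - ((2 * x - 1) / b)\<^sup>2) = 2 / sqrt (real n) * sqrt V / b"
      using b(1) by (simp add: real_sqrt_divide real_sqrt_mult)
    moreover have "(F has_real_derivative inverse (sqrt (1 - ((2 * x - 1) / b)\<^sup>2)) * (2 / b) / sqrt (real n)) (at x)"
      unfolding F_def
    proof (rule DERIV_cdivide, rule DERIV_chain2[where f = arcsin])
      show "((\<lambda>x. (2 * x - 1) / b) has_real_derivative 2 / b) (at x)"
        using b by (auto intro!: derivative_eq_intros)
      show "(arcsin has_real_derivative inverse (sqrt (1 - ((2 * x - 1) / b)\<^sup>2))) (at ((2 * x - 1) / b))"
        using lt by (rule DERIV_arcsin)
    qed
    ultimately have "(F has_real_derivative 1 / sqrt V) (at x)"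
      using n b by (simp add: field_simps)
    then show ?thesis unfolding V_def by (rule has_field_derivative_at_within)
  qed
  then have "((\<lambda>x. 1 / sqrt (real n * x * (1 - x) + 1/12)) has_integral F (1 - \<delta>) - F \<delta>) {\<delta>..1 - \<delta>}"
    using \<delta> by (intro fundamental_theorem_of_calculus)
      (auto simp: has_real_derivative_iff_has_vector_derivative[symmetric])
  moreover have "F \<delta> = - (arcsin ((1 - 2 * \<delta>) / b) / sqrt (real n))"
  proof -
    have "(2 * \<delta> - 1) / b = - ((1 - 2 * \<delta>) / b)" using b by (simp add: divide_simps)
    moreover have "- 1 \<le> (1 - 2 * \<delta>) / b" "(1 - 2 * \<delta>) / b \<le> 1"
      using b \<delta> by (simp_all add: divide_simps)
    ultimately show ?thesis unfolding F_def by (simp only: arcsin_minus)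
  qed
  moreover have "F (1 - \<delta>) = arcsin ((1 - 2 * \<delta>) / b) / sqrt (real n)" by (simp add: F_def)
  ultimately show ?thesis by (simp add: b_def)
qed

text \<open>With the mirror image that follows, this bounds the posterior mass on the truncated
  interval for the outputs 0 and n, the two outputs shared with the atoms.\<close>

lemma integral_one_minus_power_le:
  assumes "0 \<le> \<delta>" "\<delta> \<le> 1/2"
  shows "integral {\<delta>..1 - \<delta>} (\<lambda>x. (1 - x) ^ n) \<le> (1 - \<delta>) ^ Suc n / (real n + 1)"
proof -
  define F :: "real \<Rightarrow> real" where "F x = - ((1 - x) ^ Suc n / (real n + 1))" for x
  have "(F has_vector_derivative (1 - x) ^ n) (at x within S)" for x S
    unfolding F_def has_real_derivative_iff_has_vector_derivative[symmetric]
    by (rule derivative_eq_intros refl | simp add: add.commute)+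
  then have "((\<lambda>x. (1 - x) ^ n) has_integral (F (1 - \<delta>) - F \<delta>)) {\<delta>..1 - \<delta>}"
    using assms by (intro fundamental_theorem_of_calculus) auto
  moreover have "F (1 - \<delta>) \<le> 0" using assms by (simp add: F_def)
  ultimately show ?thesis by (auto simp: F_def integral_unique)
qed

lemma integral_power_le:
  assumes "0 \<le> \<delta>" "\<delta> \<le> 1/2"
  shows "integral {\<delta>..1 - \<delta>} (\<lambda>x. x ^ n) \<le> (1 - \<delta>) ^ Suc n / (real n + 1)"
proof -
  define F :: "real \<Rightarrow> real" where "F x = x ^ Suc n / (real n + 1)" for x
  have "(F has_vector_derivative x ^ n) (at x within S)" for x S
    unfolding F_def has_real_derivative_iff_has_vector_derivative[symmetric]
    by (rule derivative_eq_intros refl | simp add: add.commute)+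
  then have "((\<lambda>x. x ^ n) has_integral (F (1 - \<delta>) - F \<delta>)) {\<delta>..1 - \<delta>}"
    using assms by (intro fundamental_theorem_of_calculus) auto
  moreover have "0 \<le> F \<delta>" using assms by (simp add: F_def)
  ultimately show ?thesis by (auto simp: F_def integral_unique)
qed

text \<open>For the outputs 0 and n the posterior mass on the interval is at most w; dividing it by
  R leaves 1 - w / R for the atom at the matching endpoint. The atoms contribute this amount to the
  integral of h without loss, since their output is deterministic. At an interior x the division
  costs (x^n + (1 - x)^n) ln R in the exponent, and the remaining sum of W ln W is bounded by
  \<open>binomial_entropy_le\<close>.\<close>

lemma capacity_ge_mixed_input:
  fixes \<delta> R :: real
  assumes n: "n \<ge> 1" and \<delta>: "0 < \<delta>" "\<delta> < 1/2" and R: "1 \<le> R"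
  defines "w \<equiv> (1 - \<delta>) ^ Suc n"
  shows "ln (2 * (1 - w / R)
           + integral {\<delta>..1 - \<delta>} (\<lambda>x. (real n + 1) / sqrt (2 * pi * exp 1 * (real n * x * (1 - x) + 1/12))
               * R powr (- (x ^ n + (1 - x) ^ n)))) \<le> capacity n"
proof -
  define \<theta> where "\<theta> = 1 - w / R"
  \<comment> \<open>Strictness keeps \<theta> positive even for R = 1, as the logarithms at the
    atoms require.\<close>
  have "w < 1" unfolding w_def using \<delta> by (intro power_Suc_less_one) auto
  then have \<theta>: "0 < \<theta>" "\<theta> \<le> 1" using R \<delta> by (auto simp: \<theta>_def w_def)
  define I where "I = {\<delta>..1 - \<delta>}"
  define c where "c x = (real n + 1) / sqrt (2 * pi * exp 1 * (real n * x * (1 - x) + 1/12))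
               * R powr (- (x ^ n + (1 - x) ^ n))" for x
  \<comment> \<open>Clamping the real line to the unit interval turns Lebesgue measure outside it into the two atoms.\<close>
  define \<phi> :: "real \<Rightarrow> real" where "\<phi> u = max 0 (min 1 u)" for u
  \<comment> \<open>The intervals [-1, 0) and (1, 2] have length 1, so each atom has weight \<theta>
    in the integral; they are disjoint from I, so at each u at most one summand is nonzero.\<close>
  define h where "h u = \<theta> * indicator {-1..<0} u + \<theta> * indicator {1<..2} u + indicator I u * c u" for u
  define r where "r y = (if y = 0 \<or> y = n then 1 / R else 1)" for y
  define k where "k u y = (if y = 0 then \<theta> else 0) * indicator {-1..<0} u
      + (if y = n then \<theta> else 0) * indicator {1<..2} u
      + indicator I u * ((real n + 1) * r y * binom_W n u y)" for u y
  have var_pos: "0 < real n * x * (1 - x) + 1/12" if "x \<in> {0..1}" for x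
    using that by (intro add_nonneg_pos) auto
  have I01: "x \<in> {0..1}" "0 < x" "x < 1" if "x \<in> I" for x using that \<delta> by (auto simp: I_def)
  have c_pos: "0 < c x" if "x \<in> I" for x
    unfolding c_def using var_pos[OF I01(1)[OF that]] R by (intro mult_pos_pos divide_pos_pos) auto
  have c_cont: "continuous_on I c"
    unfolding c_def using var_pos I01 R by (auto intro!: continuous_intros simp: less_imp_neq[symmetric])
  have W_cont: "continuous_on I (\<lambda>x. (real n + 1) * r y * binom_W n x y)" for y
    unfolding binom_W_def by (intro continuous_intros)
  have int_I: "integrable lborel (\<lambda>x. indicator I x * f x)" if "continuous_on I f" for f :: "real \<Rightarrow> real"
    using borel_integrable_atLeastAtMost'[of \<delta> "1 - \<delta>" f] that by (simp add: I_def set_integrable_def)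
  have eq_I: "(\<integral>x. indicator I x * f x \<partial>lborel) = integral I f" if "continuous_on I f" for f :: "real \<Rightarrow> real"
    using set_borel_integral_eq_integral(2)[of I f] int_I[OF that]
    by (simp add: set_integrable_def set_lebesgue_integral_def)
  have int_atoms: "integrable lborel (\<lambda>u. a * indicator {-1..<0::real} u :: real)"
      "integrable lborel (\<lambda>u. a * indicator {1<..2::real} u :: real)" for a
    by (auto intro!: integrable_real_indicator)
  have val_atoms: "(\<integral>u. a * indicator {-1..<0::real} u \<partial>lborel) = (a :: real)"
      "(\<integral>u. a * indicator {1<..2::real} u \<partial>lborel) = (a :: real)" for a
    by auto
  have h_int: "integrable lborel h"
    unfolding h_def using int_atoms int_I[OF c_cont] by (intro Bochner_Integration.integrable_add) auto
  have h_val: "integral\<^sup>L lborel h = 2 * \<theta> + integral I c"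
    unfolding h_def using int_atoms int_I[OF c_cont]
    by (subst Bochner_Integration.integral_add, simp, simp, subst Bochner_Integration.integral_add)
       (simp_all add: eq_I[OF c_cont])
  have k_int: "integrable lborel (\<lambda>u. k u y)" for y
    unfolding k_def using int_I[OF W_cont] int_atoms by (intro Bochner_Integration.integrable_add) auto
  have k_val: "(\<integral>u. k u y \<partial>lborel) = (if y = 0 then \<theta> else 0) + (if y = n then \<theta> else 0)
      + (real n + 1) * r y * integral I (\<lambda>x. binom_W n x y)" for y
    unfolding k_def using int_atoms int_I[OF W_cont]
    by (subst Bochner_Integration.integral_add, simp, simp, subst Bochner_Integration.integral_add)
       (simp_all add: eq_I[OF W_cont])
  have k_nonneg: "0 \<le> k u y" for u y
    using \<theta> R binom_W_nonneg[OF I01(1), of u n y]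
    by (auto simp: k_def r_def indicator_def)
  have k_le: "(\<integral>u. k u y \<partial>lborel) \<le> 1" if y: "y \<le> n" for y
  proof -
    consider "y = 0" | "y = n" "y \<noteq> 0" | "0 < y" "y < n" using y by linarith
    then show ?thesis
    proof cases
      case 1
      have "integral I (\<lambda>x. binom_W n x 0) \<le> w / (real n + 1)"
        using integral_one_minus_power_le[of \<delta> n] \<delta> by (simp add: binom_W_def I_def w_def)
      then have "(real n + 1) * integral I (\<lambda>x. binom_W n x 0) \<le> w"
        by (simp add: field_simps)
      then have "(real n + 1) * integral I (\<lambda>x. binom_W n x 0) / R \<le> w / R"
        using R by (intro divide_right_mono) auto
      then show ?thesis using 1 n by (simp add: k_val r_def \<theta>_def)
    next
      case 2
      have "integral I (\<lambda>x. binom_W n x n) \<le> w / (real n + 1)"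
        using integral_power_le[of \<delta> n] \<delta> by (simp add: binom_W_def I_def w_def)
      then have "(real n + 1) * integral I (\<lambda>x. binom_W n x n) \<le> w"
        by (simp add: field_simps)
      then have "(real n + 1) * integral I (\<lambda>x. binom_W n x n) / R \<le> w / R"
        using R by (intro divide_right_mono) auto
      then show ?thesis using 2 n by (simp add: k_val r_def \<theta>_def)
    next
      case 3
      have "integral I (\<lambda>x. binom_W n x y) \<le> integral {0..1} (\<lambda>x. binom_W n x y)"
      proof (rule integral_subset_le)
        show "(\<lambda>x. binom_W n x y) integrable_on I"
          unfolding I_def binom_W_def by (intro integrable_continuous_real continuous_intros)
        show "(\<lambda>x. binom_W n x y) integrable_on {0..1}"
          using has_integral_binom_W[OF y] by blast
      qed (use I01 in \<open>auto simp: binom_W_nonneg\<close>)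
      also have "\<dots> = 1 / (real n + 1)" using has_integral_binom_W[OF y] by (rule integral_unique)
      finally show ?thesis using 3 by (simp add: k_val r_def field_simps)
    qed
  qed
  have W0: "binom_W n 0 y = (if y = 0 then 1 else 0)" for y
    by (simp add: binom_W_def power_0_left)
  have W1: "binom_W n 1 y = (if y = n then 1 else 0)" if "y \<le> n" for y
    using that by (auto simp: binom_W_def power_0_left)
  have cases_u: "u \<in> {-1..<0} \<or> u \<in> {1<..2} \<or> u \<in> I" if "0 < h u" for u
    using that by (auto simp: h_def indicator_def of_bool_def split: if_splits)
  have on0: "\<phi> u = 0" "h u = \<theta>" "k u y = (if y = 0 then \<theta> else 0)" if "u \<in> {-1..<0}" for u y
    using that \<delta> by (auto simp: \<phi>_def h_def k_def I_def indicator_def)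
  have on1: "\<phi> u = 1" "h u = \<theta>" "k u y = (if y = n then \<theta> else 0)" if "u \<in> {1<..2}" for u y
    using that \<delta> by (auto simp: \<phi>_def h_def k_def I_def indicator_def)
  have onI: "\<phi> u = u" "h u = c u" "k u y = (real n + 1) * r y * binom_W n u y" if "u \<in> I" for u y
    using that \<delta> by (auto simp: \<phi>_def h_def k_def I_def indicator_def)
  have "ln (integral\<^sup>L lborel h) \<le> capacity n"
  proof (rule capacity_ge_ln_integral[where \<phi> = \<phi> and k = k])
    show "\<phi> \<in> borel_measurable lborel" unfolding \<phi>_def by measurable
    show "\<phi> u \<in> {0..1}" for u by (auto simp: \<phi>_def)
    show "0 \<le> h u" for u using \<theta> c_pos[of u] by (auto simp: h_def indicator_def)
    show "0 < integral\<^sup>L lborel h"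
      unfolding h_val using \<theta> c_pos
      by (intro add_pos_nonneg Henstock_Kurzweil_Integration.integral_nonneg)
         (auto simp: I_def less_imp_le intro!: integrable_continuous_real c_cont[unfolded I_def])
    show "0 < k u y" if "0 < h u" "y \<le> n" "0 < binom_W n (\<phi> u) y" for u y
      using cases_u[OF that(1)]
    proof (elim disjE)
      assume u: "u \<in> I"
      have "0 < binom_W n u y" using that(3) onI(1)[OF u] by simp
      then show ?thesis unfolding onI(3)[OF u] using R by (intro mult_pos_pos) (auto simp: r_def)
    qed (use that \<theta> in \<open>simp_all add: on0 on1 W0 W1 split: if_splits\<close>)
    show "ln (h u) \<le> (\<Sum>y\<le>n. binom_W n (\<phi> u) y * ln (k u y))" if "0 < h u" for u
      using cases_u[OF that]
    proof (elim disjE)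
      assume u: "u \<in> {-1..<0}"
      have "(\<Sum>y\<le>n. binom_W n (\<phi> u) y * ln (k u y)) = (\<Sum>y\<le>n. if y = 0 then ln \<theta> else 0)"
        using on0[OF u] by (intro sum.cong) (auto simp: W0)
      then show ?thesis using on0[OF u] by simp
    next
      assume u: "u \<in> {1<..2}"
      have "(\<Sum>y\<le>n. binom_W n (\<phi> u) y * ln (k u y)) = (\<Sum>y\<le>n. if y = n then ln \<theta> else 0)"
        using on1[OF u] by (intro sum.cong) (auto simp: W1)
      then show ?thesis using on1[OF u] by simp
    next
      assume u: "u \<in> I"
      have W: "0 < binom_W n u y" if "y \<le> n" for y
        using that I01[OF u] by (simp add: binom_W_def)
      have r_pos: "0 < r y" for y using R by (simp add: r_def)
      have ln_k: "ln (k u y) = ln (real n + 1) + ln (binom_W n u y) + ln (r y)" if "y \<le> n" for y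
        unfolding onI(3)[OF u] using W[OF that] r_pos[of y] by (simp add: ln_mult)
      have "(\<Sum>y\<le>n. binom_W n (\<phi> u) y * ln (k u y))
          = (\<Sum>y\<le>n. binom_W n u y * ln (real n + 1) + binom_W n u y * ln (binom_W n u y) + binom_W n u y * ln (r y))"
        using onI[OF u] ln_k by (intro sum.cong) (simp_all add: distrib_left)
      also have "\<dots> = ln (real n + 1) + (\<Sum>y\<le>n. binom_W n u y * ln (binom_W n u y)) + (\<Sum>y\<le>n. binom_W n u y * ln (r y))"
        by (simp add: sum.distrib sum_binom_W flip: sum_distrib_right)
      \<comment> \<open>Only the outputs 0 and n are discounted, and their probabilities at u are (1
        - u)^n and u^n.\<close>
      also have "(\<Sum>y\<le>n. binom_W n u y * ln (r y)) = (\<Sum>y\<in>{0, n}. binom_W n u y * ln (r y))"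
        by (rule sum.mono_neutral_right) (auto simp: r_def)
      also have "\<dots> = - (u ^ n + (1 - u) ^ n) * ln R"
        using n R by (simp add: r_def binom_W_def ln_div algebra_simps)
      finally have "(\<Sum>y\<le>n. binom_W n (\<phi> u) y * ln (k u y)) = ln (real n + 1)
          + (\<Sum>y\<le>n. binom_W n u y * ln (binom_W n u y)) + - (u ^ n + (1 - u) ^ n) * ln R" .
      moreover have "ln (h u) = ln (real n + 1) - ln (2 * pi * exp 1 * (real n * u * (1 - u) + 1/12)) / 2
          + - (u ^ n + (1 - u) ^ n) * ln R"
      proof -
        have "0 < 2 * pi * exp 1 * (real n * u * (1 - u) + 1/12)"
          using var_pos[OF I01(1)[OF u]] by simp
        then show ?thesis
          unfolding onI(2)[OF u] c_def using R var_pos[OF I01(1)[OF u]] by (simp add: ln_mult ln_div ln_sqrt ln_powr)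
      qed
      ultimately show ?thesis using binomial_entropy_le[OF I01(1)[OF u], of n] by linarith
    qed
  qed (simp_all add: h_int k_int k_nonneg k_le)
  then show ?thesis by (simp add: h_val \<theta>_def I_def c_def[abs_def])
qed

section \<open>Reduction of the two bounds to one inequality without logarithms\<close>

text \<open>The quadratic Taylor bound at 1/8, raised to the eighth power: (145/128)^8 =
  2.7118...\<close>

lemma exp_one_ge: "2711/1000 \<le> exp (1 :: real)"
proof -
  have "1 + 1/8 + (1/8)\<^sup>2 / 2 \<le> exp (1/8 :: real)"
    by (rule exp_lower_Taylor_quadratic) simp
  then have "(1 + 1/8 + (1/8)\<^sup>2 / 2) ^ 8 \<le> exp (1/8 :: real) ^ 8"
    by (rule power_mono) simp
  also have "\<dots> = exp 1" by (simp flip: exp_of_nat_mult)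
  finally show ?thesis by (simp add: power2_eq_square power_divide)
qed

lemma exp_inverse_Suc_le:
  assumes "n \<ge> 1"
  shows "exp (1 / (real n + 1)) \<le> (real n + 1) / real n"
proof -
  have "1 + (- (1 / (real n + 1))) \<le> exp (- (1 / (real n + 1)))"
    by (rule exp_ge_add_one_self)
  then have "real n / (real n + 1) \<le> inverse (exp (1 / (real n + 1)))"
    by (simp add: exp_minus field_simps)
  then show ?thesis using assms by (simp add: field_simps)
qed

text \<open>The exponential of the second bound, with its only transcendental correction exp (1 / (n
  + 1)) enlarged to (n + 1) / n. What remains to be shown about X contains only roots, \<pi> and
  e.\<close>

lemma lower_bound_le_ln:
  fixes n :: nat and X :: real
  assumes n: "n \<ge> 1"
    and X: "(real n + 1) / real n * sqrt (real n * pi / (2 * exp 1)) * sqrt (3 * real n / (3 * real n + 1))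
          * (1 + 1 / sqrt (3 * real n + 1)) \<le> X"
  shows "ln (real n * pi / (2 * exp 1)) / 2
            + (- ln (1 + 1 / (3 * real n)) / 2 + ln (1 + 1 / sqrt (3 * real n + 1)) + 1 / (real n + 1)) \<le> ln X"
proof -
  define A B where "A = real n * pi / (2 * exp 1)" and "B = 1 + 1 / sqrt (3 * real n + 1)"
  define C where "C = 3 * real n / (3 * real n + 1)"
  have pos: "0 < A" "0 < C" using n by (simp_all add: A_def C_def)
  have "0 < B" unfolding B_def by (intro add_pos_nonneg) auto
  note pos = pos this
  have "1 + 1 / (3 * real n) = 1 / C" using n by (simp add: C_def field_simps)
  then have "ln A / 2 + (- ln (1 + 1 / (3 * real n)) / 2 + ln B + 1 / (real n + 1))
      = ln (exp (1 / (real n + 1)) * sqrt A * sqrt C * B)"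
    using pos by (simp add: ln_mult ln_sqrt ln_div)
  also have "\<dots> \<le> ln ((real n + 1) / real n * sqrt A * sqrt C * B)"
  proof -
    have "exp (1 / (real n + 1)) * sqrt A * sqrt C * B \<le> (real n + 1) / real n * sqrt A * sqrt C * B"
      using exp_inverse_Suc_le[OF n] pos by (intro mult_right_mono) auto
    then show ?thesis using pos by (intro ln_mono) auto
  qed
  also have "\<dots> \<le> ln X"
    using X pos n unfolding A_def B_def C_def by (intro ln_mono) (auto intro!: mult_pos_pos divide_pos_pos)
  finally show ?thesis by (simp add: A_def B_def)
qed

text \<open>Put s = sqrt (3 n + 1). After expanding the logarithms, the second bound minus the first
  is ln n - \<psi>(n + 1) + 2 ln (1 + 1 / s) + 1 / (n + 1). As \<psi>(n + 1) <= ln n + 1 / n, it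
  suffices that 1 / n - 1 / (n + 1) <= 2 ln (1 + 1 / s).\<close>

lemma Digamma_bound_le:
  assumes n: "n \<ge> 1"
  shows "Digamma (real n + 1) - ln (1 + sqrt (3 * real n + 1)) + ln (3 * pi / (2 * exp 1)) / 2
      \<le> ln (real n * pi / (2 * exp 1)) / 2
            + (- ln (1 + 1 / (3 * real n)) / 2 + ln (1 + 1 / sqrt (3 * real n + 1)) + 1 / (real n + 1))"
proof -
  define s where "s = sqrt (3 * real n + 1)"
  have s: "s > 0" "s\<^sup>2 = 3 * real n + 1" by (auto simp: s_def)
  obtain m where m: "n = Suc m" using n by (cases n) auto
  have "Digamma (real n + 1) = harm n - euler_mascheroni"
    using Digamma_of_nat[of n, where 'a=real] by (simp add: add.commute)
  also have "\<dots> \<le> ln (real n + 1) - 1 / (2 * (real n + 1))"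
    using euler_mascheroni_lower[of m] by (simp add: m add.commute)
  also have "\<dots> \<le> ln (real n + 1)" by simp
  also have "\<dots> \<le> ln (real n) + 1 / real n"
  proof -
    have "ln (1 + 1 / real n) \<le> 1 / real n" by (rule ln_add_one_self_le_self) simp
    moreover have "1 + 1 / real n = (real n + 1) / real n" using n by (simp add: field_simps)
    ultimately show ?thesis using n by (simp add: ln_div)
  qed
  finally have dig: "Digamma (real n + 1) \<le> ln (real n) + 1 / real n" .
  have "1 \<le> real n" using n by simp
  have "s \<le> 2 * real n"
  proof (rule power2_le_imp_le)
    have "1 * real n \<le> real n * real n" using n by (intro mult_right_mono) auto
    then show "s\<^sup>2 \<le> (2 * real n)\<^sup>2" unfolding s(2) unfolding power2_eq_square using \<open>1 \<le> real n\<close> by linarith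
  qed simp
  moreover have "1 * real n \<le> real n * real n" using n by (intro mult_right_mono) auto
  ultimately have "1 + s \<le> 2 * (real n * (real n + 1))"
    unfolding distrib_left mult_1_right using \<open>1 \<le> real n\<close> by linarith
  then have "1 / (real n * (real n + 1)) \<le> 2 / (1 + s)"
    using n s by (simp add: field_simps)
  also have "\<dots> \<le> 2 * ln (1 + 1 / s)"
  proof -
    have "ln (s / (1 + s)) \<le> s / (1 + s) - 1" using s by (intro ln_le_minus_one) simp
    also have "s / (1 + s) - 1 = - (1 / (1 + s))" using s by (simp add: field_simps)
    finally have "1 / (1 + s) \<le> - ln (s / (1 + s))" by simp
    also have "\<dots> = ln (1 + 1 / s)"
    proof -
      have "1 + 1 / s = (1 + s) / s" using s by (simp add: field_simps)
      then show ?thesis using s by (simp add: ln_div)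
    qed
    finally show ?thesis by simp
  qed
  finally have A: "1 / real n - 1 / (real n + 1) \<le> 2 * ln (1 + 1 / s)"
    using n by (simp add: field_simps)
  have e1: "ln (1 + s) = ln s + ln (1 + 1 / s)"
  proof -
    have "1 + 1 / s = (1 + s) / s" using s by (simp add: field_simps)
    then show ?thesis using s by (simp add: ln_div)
  qed
  have e2: "ln s = ln (3 * real n) / 2 + ln (1 + 1 / (3 * real n)) / 2"
  proof -
    have "3 * real n + 1 = 3 * real n * (1 + 1 / (3 * real n))" using n by (simp add: field_simps)
    then have "ln (3 * real n + 1) = ln (3 * real n) + ln (1 + 1 / (3 * real n))"
      using n by (metis ln_mult_pos of_nat_0_less_iff add_pos_pos divide_pos_pos less_le_trans zero_less_mult_iff zero_less_numeral zero_less_one)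
    then show ?thesis by (simp add: s_def ln_sqrt)
  qed
  have e3: "ln (3 * real n) = ln 3 + ln (real n)" using n by (simp add: ln_mult)
  have e4: "ln (3 * pi / (2 * exp 1)) = ln 3 + ln (pi / (2 * exp 1))"
    using ln_mult_pos[of 3 "pi / (2 * exp 1)"] by simp
  have e5: "ln (real n * pi / (2 * exp 1)) = ln (real n) + ln (pi / (2 * exp 1))"
    using n ln_mult_pos[of "real n" "pi / (2 * exp 1)"] by simp
  show ?thesis using dig A e1 e2 e3 e4 e5 unfolding s_def[symmetric] by argo
qed

section \<open>A rational criterion for the three-point input\<close>

text \<open>All hypotheses are rational, so each n is settled by computation: \<rho> bounds (1 -
  \<theta>) powr (2 / 2^n) from below, a bounds 1 / sqrt (3 n + 1) from above, 0.5795 bounds \<pi> /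
  (2 e) from above, and squaring removes the other roots.\<close>

lemma capacity_ge_small:
  assumes n: "n \<ge> 1" and \<theta>: "0 < \<theta>" "\<theta> < 1" and \<rho>: "0 < \<rho>" "\<rho> ^ (2 ^ (n - 1)) \<le> 1 - \<theta>"
    and a: "0 \<le> a" "1 \<le> a\<^sup>2 * (3 * real n + 1)"
    and le: "((real n + 1) / real n)\<^sup>2 * (real n * 5795/10000) * (3 * real n / (3 * real n + 1)) * (1 + a)\<^sup>2
        \<le> (2 * \<theta> + \<rho>)\<^sup>2"
  shows "ln (real n * pi / (2 * exp 1)) / 2
            + (- ln (1 + 1 / (3 * real n)) / 2 + ln (1 + 1 / sqrt (3 * real n + 1)) + 1 / (real n + 1)) \<le> capacity n"
proof -
  have "\<rho> = (\<rho> powr real (2 ^ (n - 1))) powr (2 / 2 ^ n)"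
    using n \<rho> by (cases n) (simp_all add: powr_powr)
  also have "\<dots> = (\<rho> ^ (2 ^ (n - 1))) powr (2 / 2 ^ n)"
    using \<rho>(1) by (simp only: powr_realpow)
  also have "\<dots> \<le> (1 - \<theta>) powr (2 / 2 ^ n)"
    using \<rho> by (intro powr_mono2) auto
  finally have "ln (2 * \<theta> + \<rho>) \<le> ln (2 * \<theta> + (1 - \<theta>) powr (2 / 2 ^ n))"
    using \<theta> \<rho> by (intro ln_mono) auto
  also have "\<dots> \<le> capacity n" using n \<theta> by (rule capacity_ge_three_point)
  finally have cap: "ln (2 * \<theta> + \<rho>) \<le> capacity n" .
  have "(real n + 1) / real n * sqrt (real n * pi / (2 * exp 1)) * sqrt (3 * real n / (3 * real n + 1))
          * (1 + 1 / sqrt (3 * real n + 1)) \<le> 2 * \<theta> + \<rho>"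
  proof (rule power2_le_imp_le)
    have "pi \<le> 1159/1000 * (2711/1000)" using pi_approx(2) by simp
    also have "\<dots> \<le> 1159/1000 * exp 1" using exp_one_ge by (intro mult_left_mono) auto
    finally have "pi / (2 * exp 1) \<le> 5795/10000" by (simp add: field_simps)
    then have 1: "real n * pi / (2 * exp 1) \<le> real n * 5795/10000"
      using mult_left_mono[of "pi / (2 * exp 1)" "5795/10000" "real n"] by simp
    have "1 / sqrt (3 * real n + 1) \<le> a"
    proof -
      have "1 \<le> sqrt (a\<^sup>2 * (3 * real n + 1))" using a(2) by (simp only: real_sqrt_ge_1_iff)
      also have "\<dots> = a * sqrt (3 * real n + 1)" using a(1) by (simp add: real_sqrt_mult)
      finally show ?thesis by (simp add: divide_le_eq add_pos_nonneg)
    qed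
    then have 2: "(1 + 1 / sqrt (3 * real n + 1))\<^sup>2 \<le> (1 + a)\<^sup>2"
      by (intro power_mono) (auto intro: add_nonneg_nonneg)
    have "((real n + 1) / real n * sqrt (real n * pi / (2 * exp 1)) * sqrt (3 * real n / (3 * real n + 1))
          * (1 + 1 / sqrt (3 * real n + 1)))\<^sup>2
        = ((real n + 1) / real n)\<^sup>2 * (real n * pi / (2 * exp 1)) * (3 * real n / (3 * real n + 1))
          * (1 + 1 / sqrt (3 * real n + 1))\<^sup>2"
      by (simp only: power_mult_distrib) simp
    also have "\<dots> \<le> ((real n + 1) / real n)\<^sup>2 * (real n * 5795/10000) * (3 * real n / (3 * real n + 1)) * (1 + a)\<^sup>2"
      using 1 2 by (intro mult_mono) auto
    finally show "((real n + 1) / real n * sqrt (real n * pi / (2 * exp 1)) * sqrt (3 * real n / (3 * real n + 1))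
          * (1 + 1 / sqrt (3 * real n + 1)))\<^sup>2 \<le> (2 * \<theta> + \<rho>)\<^sup>2"
      using le by linarith
  qed (use \<theta> \<rho> in simp)
  then show ?thesis using lower_bound_le_ln[OF n] cap by fastforce
qed

section \<open>The mixed input for n >= 10\<close>

text \<open>Linearise: R powr (- s) >= 1 - s ln R. The constant term integrates to the arcsine. In
  the correction, 1 / sqrt (n x (1 - x) + 1/12) is replaced by its maximum, attained at x =
  \<delta>, and x^n + (1 - x)^n integrates to at most 2 (1 - \<delta>)^(n + 1) / (n + 1).\<close>

lemma integral_mixed_input_ge:
  fixes \<delta> R :: real
  assumes n: "n \<ge> 1" and \<delta>: "0 < \<delta>" "\<delta> < 1/2" and R: "1 \<le> R"
  shows "((real n + 1) / sqrt (real n) * (2 * arcsin ((1 - 2 * \<delta>) / sqrt (1 + 1 / (3 * real n))))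
           - 2 * ln R * (1 - \<delta>) ^ Suc n / sqrt (real n * \<delta> * (1 - \<delta>) + 1/12)) / sqrt (2 * pi * exp 1)
       \<le> integral {\<delta>..1 - \<delta>} (\<lambda>x. (real n + 1) / sqrt (2 * pi * exp 1 * (real n * x * (1 - x) + 1/12))
               * R powr (- (x ^ n + (1 - x) ^ n)))" (is "?lhs \<le> integral ?I ?c")
proof -
  define g where "g x = 1 / sqrt (real n * x * (1 - x) + 1/12)" for x
  define K where "K = (real n + 1) / sqrt (2 * pi * exp 1)"
  define s where "s x = x ^ n + (1 - x) ^ n" for x :: real
  define w where "w = (1 - \<delta>) ^ Suc n"
  define A where "A = 2 * arcsin ((1 - 2 * \<delta>) / sqrt (1 + 1 / (3 * real n))) / sqrt (real n)"
  have K: "0 < K" by (simp add: K_def add_nonneg_pos)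
  have lnR: "0 \<le> ln R" using R by simp
  have var_pos: "0 < real n * x * (1 - x) + 1/12" if "x \<in> ?I" for x
    using that \<delta> by (intro add_nonneg_pos) auto
  have g\<delta>: "0 < g \<delta>" using var_pos[of \<delta>] \<delta> by (simp add: g_def)
  have pw: "K * g x - K * (ln R * g \<delta>) * s x \<le> ?c x" if x: "x \<in> ?I" for x
  proof -
    have s: "0 \<le> s x" using x \<delta> by (simp add: s_def)
    have gx: "0 < g x" using var_pos[OF x] by (simp add: g_def)
    have "0 \<le> (x - \<delta>) * ((1 - \<delta>) - x)" using x by simp
    then have "\<delta> * (1 - \<delta>) \<le> x * (1 - x)" by (simp add: algebra_simps)
    then have "real n * (\<delta> * (1 - \<delta>)) \<le> real n * (x * (1 - x))" by (intro mult_left_mono) auto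
    then have "g x \<le> g \<delta>"
      unfolding g_def using var_pos[OF x] var_pos[of \<delta>] \<delta> by (intro divide_left_mono) (auto simp: mult.assoc)
    then have "K * (ln R * g x) * s x \<le> K * (ln R * g \<delta>) * s x"
      using K lnR s by (intro mult_right_mono mult_left_mono) auto
    then have "K * g x - K * (ln R * g \<delta>) * s x \<le> K * g x * (1 + - s x * ln R)"
      by (simp add: algebra_simps)
    also have "\<dots> \<le> K * g x * exp (- s x * ln R)"
      using K gx by (intro mult_left_mono exp_ge_add_one_self) auto
    also have "\<dots> = ?c x"
      using R by (simp add: K_def g_def s_def powr_def real_sqrt_mult)
    finally show ?thesis .
  qed
  have g_int: "(g has_integral A) ?I"
    using has_integral_inverse_sqrt_quadratic[OF n, of \<delta>] \<delta> unfolding g_def A_def by simp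
  have s_int: "(s has_integral (integral ?I (\<lambda>x. x ^ n) + integral ?I (\<lambda>x. (1 - x) ^ n))) ?I"
    unfolding s_def by (intro has_integral_add integrable_integral integrable_continuous_real continuous_intros)
  have "integral ?I (\<lambda>x. x ^ n) + integral ?I (\<lambda>x. (1 - x) ^ n) \<le> 2 * w / (real n + 1)"
    using integral_power_le[of \<delta> n] integral_one_minus_power_le[of \<delta> n] \<delta> by (simp add: w_def)
  then have "K * (ln R * g \<delta>) * (integral ?I (\<lambda>x. x ^ n) + integral ?I (\<lambda>x. (1 - x) ^ n))
      \<le> K * (ln R * g \<delta>) * (2 * w / (real n + 1))"
    using K lnR g\<delta> by (intro mult_left_mono) auto
  then have "K * A - K * (ln R * g \<delta>) * (2 * w / (real n + 1))
      \<le> K * A - K * (ln R * g \<delta>) * (integral ?I (\<lambda>x. x ^ n) + integral ?I (\<lambda>x. (1 - x) ^ n))"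
    by simp
  also have "\<dots> = integral ?I (\<lambda>x. K * g x - K * (ln R * g \<delta>) * s x)"
    by (rule integral_unique[symmetric]) (intro has_integral_diff has_integral_mult_right g_int s_int)
  also have "\<dots> \<le> integral ?I ?c"
  proof (rule integral_le)
    show "(\<lambda>x. K * g x - K * (ln R * g \<delta>) * s x) integrable_on ?I"
      using has_integral_diff[OF has_integral_mult_right[OF g_int] has_integral_mult_right[OF s_int]] by blast
    have "real n * x * (1 - x) + 1/12 \<noteq> 0" if "x \<in> ?I" for x using var_pos[OF that] by simp
    then show "?c integrable_on ?I"
      using R by (intro integrable_continuous_real continuous_intros) auto
  qed (rule pw)
  also have "K * A - K * (ln R * g \<delta>) * (2 * w / (real n + 1)) = ?lhs"
  proof -
    have "K * A = (real n + 1) / sqrt (real n) * (2 * arcsin ((1 - 2 * \<delta>) / sqrt (1 + 1 / (3 * real n)))) / sqrt (2 * pi * exp 1)"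
      by (simp add: K_def A_def)
    moreover have "K * (ln R * g \<delta>) * (2 * w / (real n + 1))
        = 2 * ln R * (1 - \<delta>) ^ Suc n / sqrt (real n * \<delta> * (1 - \<delta>) + 1/12) / sqrt (2 * pi * exp 1)"
      by (simp add: K_def g_def w_def add_nonneg_eq_0_iff mult_ac)
    ultimately show ?thesis by (simp add: diff_divide_distrib)
  qed
  finally show ?thesis .
qed

lemma cos_le_quartic: "cos x \<le> 1 - x\<^sup>2 / 2 + x ^ 4 / (24 :: real)"
proof -
  obtain t where t: "cos x = (\<Sum>m<4. cos_coeff m * x ^ m) + cos (t + 1/2 * real 4 * pi) / fact 4 * x ^ 4"
    using Maclaurin_cos_expansion[of x 4] by auto
  have "cos (t + 1/2 * real 4 * pi) / fact 4 * x ^ 4 \<le> 1 / fact 4 * x ^ 4"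
    by (intro mult_right_mono divide_right_mono) auto
  moreover have "(\<Sum>m<4. cos_coeff m * x ^ m) = 1 - x\<^sup>2 / 2"
    by (simp add: eval_nat_numeral cos_coeff_Suc sin_coeff_Suc)
  ultimately show ?thesis unfolding t by (simp add: fact_numeral)
qed

text \<open>With t = 1 / n and B = 2.105 sqrt t the claim is cos B <= c. To first order cos^2 B is 1
  - B^2 and c^2 is 1 - 13 t / 3, so 2.105^2 must exceed 13/3; the surplus pays for the higher orders
  as long as t <= 1/10.\<close>

lemma arcsin_cutoff_ge:
  assumes n: "n \<ge> 10"
  shows "pi / 2 - 2105/1000 / sqrt (real n) \<le> arcsin ((1 - 2 * (1 / real n)) / sqrt (1 + 1 / (3 * real n)))"
proof -
  define t where "t = 1 / real n"
  have t: "0 < t" "t \<le> 1/10" using n by (auto simp: t_def field_simps)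
  define B where "B = 2105/1000 / sqrt (real n)"
  define c where "c = (1 - 2 * t) / sqrt (1 + t / 3)"
  have B2: "B\<^sup>2 = 177241/40000 * t" by (simp add: B_def t_def power_divide power2_eq_square)
  have B0: "0 < B" using n by (simp add: B_def)
  have "B\<^sup>2 \<le> 1\<^sup>2" using t by (simp add: B2)
  then have B1: "B \<le> 1" by (rule power2_le_imp_le) simp
  have c1: "0 \<le> c" "c \<le> 1"
  proof -
    have "1 - 2 * t \<le> 1" "1 \<le> sqrt (1 + t / 3)" using t by auto
    then show "0 \<le> c" "c \<le> 1" unfolding c_def using t
      by (simp, subst divide_le_eq_1_pos) linarith+
  qed
  have "B ^ 4 = (B\<^sup>2)\<^sup>2" by simp
  then have B4: "B ^ 4 = (177241/40000)\<^sup>2 * t\<^sup>2" unfolding B2 by (simp only: power_mult_distrib)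
  \<comment> \<open>The coefficients for which 1 - a t + b t^2 is the quartic upper bound of cos B:
    a t = B^2 / 2 and b t^2 = B^4 / 24.\<close>
  define a b :: real where "a = 22155125/10000000" and "b = (177241/40000)\<^sup>2 / 24"
  have "1 - a * t + b * t\<^sup>2 \<le> c"
  proof (rule power2_le_imp_le)
    \<comment> \<open>With the coefficients rounded as below, 3 (1 - 2 t)^2 minus the expanded
      square is 0.293 t - 3.203 t^2 + 4.33 t^3 + t^4 - t^5. Lowering 0.293 to 0.277 makes its cubic
      part factor with the root 1/10, which shows the sign.\<close>
    have "0 \<le> (1/10 - t) * (277/100 - 433/100 * t)" using t by (intro mult_nonneg_nonneg) auto
    then have "0 \<le> t * ((1/10 - t) * (277/100 - 433/100 * t))" using t by simp
    also have "\<dots> = 277/1000 * t - 3203/1000 * t\<^sup>2 + 433/100 * t ^ 3"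
      by (simp add: power2_eq_square power3_eq_cube field_simps)
    finally have q: "0 \<le> 277/1000 * t - 3203/1000 * t\<^sup>2 + 433/100 * t ^ 3" .
    have t4: "t ^ 5 \<le> t ^ 4" using t by (intro power_decreasing) auto
    have "(1 - a * t + b * t\<^sup>2)\<^sup>2 * (3 + t)
        = 3 + (1 - 6 * a) * t + (3 * (a\<^sup>2 + 2 * b) - 2 * a) * t\<^sup>2 + (a\<^sup>2 + 2 * b - 6 * a * b) * t ^ 3
          + (3 * b\<^sup>2 - 2 * a * b) * t ^ 4 + b\<^sup>2 * t ^ 5"
      by (simp add: algebra_simps eval_nat_numeral)
    also have "\<dots> \<le> 3 + - 12293/1000 * t + 15203/1000 * t\<^sup>2 + - 433/100 * t ^ 3 + - 1 * t ^ 4 + 1 * t ^ 5"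
      using t by (intro add_mono mult_right_mono order_refl)
        (auto simp: a_def b_def power2_eq_square)
    also have "\<dots> \<le> 3 * (1 - 4 * t + 4 * t\<^sup>2)"
      using q t4 t(1) by (simp add: algebra_simps)
    also have "\<dots> = 3 * (1 - 2 * t)\<^sup>2" by (simp add: power2_eq_square algebra_simps)
    finally have "(1 - a * t + b * t\<^sup>2)\<^sup>2 \<le> 3 * (1 - 2 * t)\<^sup>2 / (3 + t)"
      using t by (simp add: field_simps)
    also have "\<dots> = c\<^sup>2"
      using t by (simp add: c_def power_divide field_simps)
    finally show "(1 - a * t + b * t\<^sup>2)\<^sup>2 \<le> c\<^sup>2" .
  qed (rule c1)
  then have "cos B \<le> c"
    using cos_le_quartic[of B] unfolding B2 B4 a_def b_def by simp
  then have "sin (pi / 2 - B) \<le> c" by (simp add: sin_diff)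
  then have "arcsin (sin (pi / 2 - B)) \<le> arcsin c"
    using c1 by (intro arcsin_le_arcsin) auto
  moreover have "arcsin (sin (pi / 2 - B)) = pi / 2 - B"
    using B0 B1 pi_gt3 by (intro arcsin_sin) auto
  ultimately show ?thesis by (simp add: B_def c_def t_def mult.commute)
qed

text \<open>The mixed input with \<delta> = 1 / n and R = 4. After multiplication by E = sqrt (2
  \<pi> e) both sides have the same leading term (n + 1) \<pi> / sqrt n, and the comparison is
  between bounded terms: the atoms bring about 2 E, the cutoff and the division by R take part of it
  away, and the correction 1 / sqrt (3 n + 1) has to fit into the rest.\<close>

lemma capacity_ge_large:
  assumes n: "n \<ge> 10"
  shows "ln (real n * pi / (2 * exp 1)) / 2
            + (- ln (1 + 1 / (3 * real n)) / 2 + ln (1 + 1 / sqrt (3 * real n + 1)) + 1 / (real n + 1)) \<le> capacity n"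
proof -
  define N where "N = real n"
  have N: "10 \<le> N" using n by (simp add: N_def)
  define \<delta> where "\<delta> = 1 / N"
  have \<delta>: "0 < \<delta>" "\<delta> \<le> 1/10" using N by (auto simp: \<delta>_def field_simps)
  define w where "w = (1 - \<delta>) ^ Suc n"
  define E where "E = sqrt (2 * pi * exp 1)"
  define A where "A = arcsin ((1 - 2 * \<delta>) / sqrt (1 + 1 / (3 * N)))"
  define D where "D = sqrt (N * \<delta> * (1 - \<delta>) + 1/12)"
  define X where "X = 2 * (1 - w / 4) + ((N + 1) / sqrt N * (2 * A) - 2 * ln 4 * w / D) / E"
  have "(33/8)\<^sup>2 \<le> 2 * 31415/10000 * (2711/1000 :: real)" by (simp add: power2_eq_square)
  also have "\<dots> \<le> 2 * pi * exp 1"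
    using pi_approx(1) exp_one_ge by (intro mult_mono) auto
  finally have E: "33/8 \<le> E" unfolding E_def by (rule real_le_rsqrt)
  have w0: "0 \<le> w" using \<delta> by (simp add: w_def)
  \<comment> \<open>From (1 - \<delta>)^(n + 1) <= exp (- (1 + \<delta>)), with 1 / e <= 0.369 and
    exp \<delta> >= 1 + \<delta>.\<close>
  have w: "w \<le> 369/1000 * (N / (N + 1))"
  proof -
    have "w \<le> exp (- \<delta>) ^ Suc n"
      unfolding w_def using \<delta> exp_ge_add_one_self[of "- \<delta>"] by (intro power_mono) auto
    also have "\<dots> = exp (- ((N + 1) * \<delta>))"
      by (simp only: exp_of_nat_mult[symmetric]) (simp add: N_def add.commute)
    also have "(N + 1) * \<delta> = 1 + \<delta>" using N by (simp add: \<delta>_def field_simps)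
    also have "exp (- (1 + \<delta>)) = inverse (exp 1) * inverse (exp \<delta>)"
      by (simp only: exp_add exp_minus inverse_mult_distrib)
    also have "\<dots> \<le> 369/1000 * (N / (N + 1))"
    proof (intro mult_mono)
      have "inverse (exp 1) \<le> inverse (2711/1000 :: real)" using exp_one_ge by (intro le_imp_inverse_le) auto
      also have "\<dots> \<le> 369/1000" by simp
      finally show "inverse (exp 1) \<le> (369/1000 :: real)" .
      have "1 + \<delta> \<le> exp \<delta>" by (rule exp_ge_add_one_self)
      then have "inverse (exp \<delta>) \<le> inverse (1 + \<delta>)" using \<delta> by (intro le_imp_inverse_le) auto
      also have "\<dots> = N / (N + 1)" using N by (simp add: \<delta>_def field_simps)
      finally show "inverse (exp \<delta>) \<le> N / (N + 1)" .
    qed auto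
    finally show ?thesis .
  qed
  have "0 \<le> N / (N + 1)" "N / (N + 1) \<le> 1" using N by simp_all
  with w have w1: "w \<le> 1" by linarith
  have D: "0 \<le> 1 / D" "1 / D \<le> 101/100"
  proof -
    have "N * \<delta> = 1" using N by (simp add: \<delta>_def)
    then have "(100/101)\<^sup>2 \<le> N * \<delta> * (1 - \<delta>) + 1/12"
      using \<delta> by (simp add: power2_eq_square)
    then have "100/101 \<le> D" unfolding D_def by (rule real_le_rsqrt)
    then show "0 \<le> 1 / D" "1 / D \<le> 101/100" by (simp_all add: field_simps)
  qed
  have ln4: "0 \<le> ln (4 :: real)" "ln 4 \<le> (1389/1000 :: real)"
    using ln2_le_25_over_36 ln_realpow[of 2 2] by auto
  have loss: "2 * ln 4 * w / D \<le> 2806/1000 * w"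
  proof -
    have "2 * ln 4 * (1 / D) \<le> 2 * (1389/1000) * (101/100)"
      using ln4 D by (intro mult_mono) auto
    also have "\<dots> \<le> 2806/1000" by simp
    finally have "2 * ln 4 * (1 / D) * w \<le> 2806/1000 * w" using w0 by (intro mult_right_mono) auto
    then show ?thesis by (simp add: mult_ac)
  qed
  have "33/8 * (2 * (1 - w / 4)) \<le> E * (2 * (1 - w / 4))"
    using E w1 by (intro mult_right_mono) auto
  \<comment> \<open>With E >= 33/8 the atoms give 8.25 - 2.0625 w; subtracting the loss 2.806 w
    leaves 8.25 - 4.8685 w, and 4.8685 * 0.369 <= 1.797.\<close>
  then have const: "825/100 - 1797/1000 * (N / (N + 1)) \<le> E * (2 * (1 - w / 4)) - 2 * ln 4 * w / D"
    using loss w \<open>0 \<le> N / (N + 1)\<close> by argo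
  have "pi / 2 - 2105/1000 / sqrt N \<le> A"
    using arcsin_cutoff_ge[OF n] by (simp add: A_def \<delta>_def N_def)
  then have "(N + 1) / sqrt N * (pi - 421/100 / sqrt N) \<le> (N + 1) / sqrt N * (2 * A)" (is ?scaled)
    using N by (intro mult_left_mono) auto
  have main: "(N + 1) / sqrt N * pi - 421/100 * ((N + 1) / N) \<le> (N + 1) / sqrt N * (2 * A)"
  proof -
    have "(N + 1) / sqrt N * (421/100 / sqrt N) = 421/100 * ((N + 1) / (sqrt N * sqrt N))"
      by (simp only: divide_inverse inverse_mult_distrib mult_ac)
    also have "sqrt N * sqrt N = N" using N by simp
    finally have "(N + 1) / sqrt N * (421/100 / sqrt N) = 421/100 * ((N + 1) / N)" .
    with \<open>?scaled\<close> show ?thesis by (simp only: right_diff_distrib)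
  qed
  \<comment> \<open>The bounded terms. Each fraction is replaced by a linear function of \<delta>
    valid for n >= 10; the resulting inequality is tightest at \<delta> = 1/10.\<close>
  have rational: "421/100 * ((N + 1) / N) + 5442/1000 * ((N + 1) / (3 * N + 1)) \<le> 825/100 - 1797/1000 * (N / (N + 1))"
  proof -
    have 1: "(N + 1) / N = 1 + \<delta>" using N by (simp add: \<delta>_def field_simps)
    have 2: "(N + 1) / (3 * N + 1) \<le> 1/3 + 2/9 * \<delta>" using N by (simp add: \<delta>_def field_simps)
    have 3: "N / (N + 1) \<le> 1 - 10/11 * \<delta>" using N by (simp add: \<delta>_def field_simps)
    show ?thesis unfolding 1 using 2 3 \<delta> by argo
  qed
  have "E * ((N + 1) / N * sqrt (N * pi / (2 * exp 1)) * sqrt (3 * N / (3 * N + 1)) * (1 + 1 / sqrt (3 * N + 1)))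
      \<le> E * X"
  proof -
    have "E * sqrt (N * pi / (2 * exp 1)) = sqrt (pi\<^sup>2 * N)"
      unfolding E_def real_sqrt_mult[symmetric] by (simp add: field_simps power2_eq_square)
    also have "\<dots> = pi * sqrt N" by (simp add: real_sqrt_mult)
    finally have "E * ((N + 1) / N * sqrt (N * pi / (2 * exp 1)) * sqrt (3 * N / (3 * N + 1)) * (1 + 1 / sqrt (3 * N + 1)))
      = (N + 1) / N * (pi * sqrt N) * (sqrt (3 * N / (3 * N + 1)) * (1 + 1 / sqrt (3 * N + 1)))"
      by (simp add: mult_ac)
    also have "(N + 1) / N * (pi * sqrt N) = (N + 1) / sqrt N * pi"
      using N by (simp add: field_simps)
    \<comment> \<open>Bounding the first root by 1 costs only order 1 / n, whereas the second
      summand, of order 1 / sqrt n, is kept exactly; times (n + 1) \<pi> / sqrt n it gives the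
      constant \<pi> sqrt 3 <= 5.442.\<close>
    also have "sqrt (3 * N / (3 * N + 1)) * (1 + 1 / sqrt (3 * N + 1)) \<le> 1 + sqrt 3 * sqrt N / (3 * N + 1)"
    proof -
      have "sqrt (3 * N / (3 * N + 1)) * (1 + 1 / sqrt (3 * N + 1))
          = sqrt (3 * N / (3 * N + 1)) + sqrt 3 * sqrt N / (3 * N + 1)"
        using N by (simp add: real_sqrt_divide real_sqrt_mult distrib_left)
      moreover have "sqrt (3 * N / (3 * N + 1)) \<le> 1" using N by simp
      ultimately show ?thesis by simp
    qed
    then have "(N + 1) / sqrt N * pi * (sqrt (3 * N / (3 * N + 1)) * (1 + 1 / sqrt (3 * N + 1)))
        \<le> (N + 1) / sqrt N * pi * (1 + sqrt 3 * sqrt N / (3 * N + 1))"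
      using N by (intro mult_left_mono) auto
    also have "\<dots> = (N + 1) / sqrt N * pi + pi * sqrt 3 * ((N + 1) / (3 * N + 1))"
      using N by (simp add: distrib_left) (simp add: algebra_simps)
    also have "pi * sqrt 3 * ((N + 1) / (3 * N + 1)) \<le> 5442/1000 * ((N + 1) / (3 * N + 1))"
    proof (rule mult_right_mono)
      have "sqrt 3 \<le> 17321/10000" by (rule real_le_lsqrt) (auto simp: power2_eq_square)
      then have "pi * sqrt 3 \<le> 31416/10000 * (17321/10000)" using pi_approx(2) by (intro mult_mono) auto
      then show "pi * sqrt 3 \<le> 5442/1000" by simp
    qed (use N in simp)
    also have "(N + 1) / sqrt N * pi + 5442/1000 * ((N + 1) / (3 * N + 1))
        \<le> E * (2 * (1 - w / 4)) + ((N + 1) / sqrt N * (2 * A) - 2 * ln 4 * w / D)"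
      using const main rational by argo
    also have "\<dots> = E * X" using E by (simp add: X_def distrib_left)
    finally show ?thesis by simp
  qed
  then have target: "(N + 1) / N * sqrt (N * pi / (2 * exp 1)) * sqrt (3 * N / (3 * N + 1)) * (1 + 1 / sqrt (3 * N + 1)) \<le> X"
    by (rule mult_left_le_imp_le) (use E in simp)
  have "0 < (N + 1) / N * sqrt (N * pi / (2 * exp 1)) * sqrt (3 * N / (3 * N + 1)) * (1 + 1 / sqrt (3 * N + 1))"
    using N by (intro mult_pos_pos add_pos_nonneg) auto
  with target have "0 < X" by linarith
  then have "ln X \<le> ln (2 * (1 - w / 4)
           + integral {\<delta>..1 - \<delta>} (\<lambda>x. (N + 1) / sqrt (2 * pi * exp 1 * (N * x * (1 - x) + 1/12))
               * 4 powr (- (x ^ n + (1 - x) ^ n))))"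
    using integral_mixed_input_ge[of n \<delta> 4] \<delta> n
    by (intro ln_mono) (auto simp: X_def A_def D_def E_def w_def N_def)
  also have "\<dots> \<le> capacity n"
    using capacity_ge_mixed_input[of n \<delta> 4] \<delta> n by (simp add: w_def N_def)
  finally have "ln X \<le> capacity n" .
  then show ?thesis using lower_bound_le_ln[of n X] target n unfolding N_def by fastforce
qed

section \<open>The cases n <= 9\<close>

text \<open>Rounding up to \<sigma> halfway keeps the numerals short when \<rho> is raised to the
  power 128 or 256.\<close>

lemma power_le_two_steps:
  fixes \<rho> :: real
  assumes "0 \<le> \<rho>" "\<rho> ^ j \<le> \<sigma>" "\<sigma> ^ l \<le> c" "m = j * l"
  shows "\<rho> ^ m \<le> c"
proof -
  have "\<rho> ^ m = (\<rho> ^ j) ^ l" using assms by (simp add: power_mult)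
  also have "\<dots> \<le> \<sigma> ^ l" using assms by (intro power_mono) auto
  finally show ?thesis using assms by simp
qed

text \<open>Three inputs give at most ln 3, and at n = 10 the claimed bound is already larger, so
  this range cannot be extended with the same input.\<close>

lemma capacity_ge_upto_9:
  assumes n: "1 \<le> n" "n \<le> 9"
  shows "ln (real n * pi / (2 * exp 1)) / 2
            + (- ln (1 + 1 / (3 * real n)) / 2 + ln (1 + 1 / sqrt (3 * real n + 1)) + 1 / (real n + 1)) \<le> capacity n"
proof -
  consider "n = 1" | "n = 2" | "n = 3" | "n = 4" | "n = 5" | "n = 6" | "n = 7" | "n = 8" | "n = 9"
    using n by linarith
  then show ?thesis
  proof cases
    case 1
    show ?thesis
      \<comment> \<open>In all cases 1 - \<theta> is 1/16 or 1/256, so its root of order 2^(n - 1)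
        is a power of 2, for instance 1/4, 1/2, 2^(-1/2), 2^(-1/4) for n = 2, 3, 4, 5. \<rho> is
        this root rounded down, and a is 1 / sqrt (3 n + 1) rounded up.\<close>
      by (rule capacity_ge_small[where \<theta> = "255/256" and \<rho> = "3/1000" and a = "501/1000"])
         (simp_all add: 1 power2_eq_square)
  next
    case 2
    show ?thesis
      by (rule capacity_ge_small[where \<theta> = "15/16" and \<rho> = "249/1000" and a = "378/1000"])
         (simp_all add: 2 power2_eq_square power_divide)
  next
    case 3
    show ?thesis
      by (rule capacity_ge_small[where \<theta> = "15/16" and \<rho> = "499/1000" and a = "317/1000"])
         (simp_all add: 3 power2_eq_square power_divide)
  next
    case 4
    show ?thesis
      by (rule capacity_ge_small[where \<theta> = "15/16" and \<rho> = "707/1000" and a = "278/1000"])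
         (simp_all add: 4 power2_eq_square power_divide)
  next
    case 5
    show ?thesis
      by (rule capacity_ge_small[where \<theta> = "15/16" and \<rho> = "84/100" and a = "251/1000"])
         (simp_all add: 5 power2_eq_square power_divide)
  next
    case 6
    show ?thesis
      by (rule capacity_ge_small[where \<theta> = "255/256" and \<rho> = "84/100" and a = "23/100"])
         (simp_all add: 6 power2_eq_square power_divide)
  next
    case 7
    show ?thesis
      by (rule capacity_ge_small[where \<theta> = "255/256" and \<rho> = "917/1000" and a = "214/1000"])
         (simp_all add: 7 power2_eq_square power_divide)
  next
    case 8
    show ?thesis
    proof (rule capacity_ge_small[where \<theta> = "255/256" and \<rho> = "957/1000" and a = "201/1000"])
      show "(957/1000) ^ 2 ^ (n - 1) \<le> 1 - 255/(256 :: real)"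
        by (rule power_le_two_steps[where j = 8 and l = 16 and \<sigma> = "704/1000"]) (simp_all add: 8 power_divide)
    qed (simp_all add: 8 power2_eq_square)
  next
    case 9
    show ?thesis
    proof (rule capacity_ge_small[where \<theta> = "255/256" and \<rho> = "978/1000" and a = "189/1000"])
      show "(978/1000) ^ 2 ^ (n - 1) \<le> 1 - 255/(256 :: real)"
        by (rule power_le_two_steps[where j = 16 and l = 16 and \<sigma> = "7006/10000"]) (simp_all add: 9 power_divide)
    qed (simp_all add: 9 power2_eq_square)
  qed
qed

theorem theorem1:
  fixes n :: nat
  assumes "n \<ge> 1"
  shows "capacity n \<ge> Digamma (real n + 1) - ln (1 + sqrt (3 * real n + 1))
                        + ln (3 * pi / (2 * exp 1)) / 2
       \<and> capacity n \<ge> ln (real n * pi / (2 * exp 1)) / 2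
            + (- ln (1 + 1 / (3 * real n)) / 2 + ln (1 + 1 / sqrt (3 * real n + 1))
               + 1 / (real n + 1))"
proof -
  have "ln (real n * pi / (2 * exp 1)) / 2
            + (- ln (1 + 1 / (3 * real n)) / 2 + ln (1 + 1 / sqrt (3 * real n + 1))
               + 1 / (real n + 1)) \<le> capacity n"
    using capacity_ge_upto_9[of n] capacity_ge_large[of n] assms by (cases "n \<le> 9") auto
  then show ?thesis using Digamma_bound_le[OF assms] by linarith
qed

end
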